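(* Let the pencil $zB-A$ with $A,B\in\mathbb{C}^{m\times n}$, its Kronecker decomposition with nonsingular matrices $P,Q$, the region $\Omega$ with boundary curve $\Gamma$, and the matrices $J_\Omega\in\mathbb{C}^{t\times t}$, $\hat P_\Omega\in\mathbb{C}^{t\times m}$, $\hat Q_\Omega\in\mathbb{C}^{n\times t}$ and $\mathsf{M}_k\in\mathbb{C}^{n\times m}$ be as in the context, where $t$ is the number of finite eigenvalues of $zB-A$ in $\Omega$ counting multiplicity. Let $L,M$ be positive integers with $L<\min(m,n)$ and $M<n$, let $V\in\mathbb{C}^{m\times L}$, and let $$S=[\mathsf{M}_0V,\ \mathsf{M}_1V,\ \dots,\ \mathsf{M}_{M-1}V]\in\mathbb{C}^{n\times LM}.$$ Then $\operatorname{rank}(S)=t$ holds if and only if $\mathcal{R}(\hat Q_\Omega)=\mathcal{R}(S)\supseteq\mathcal{R}(X_\Omega)$ holds, where the columns of $X_\Omega$ are the eigenvectors corresponding to the eigenvalues in $\Omega$.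
   Context: Setting. $A,B\in\mathbb{C}^{m\times n}$, and the pencil $zB-A$ is assumed to have Kronecker canonical form with singular blocks of size zero only, i.e. there are nonsingular $P\in\mathbb{C}^{m\times m}$, $Q\in\mathbb{C}^{n\times n}$ with $$P(zB-A)Q=\Big(\bigoplus_{i=1}^{\ell}(z\mathrm{I}_{\eta_i}-J_i)\Big)\oplus\Big(\bigoplus_{i=1}^{p}(zN_{\rho_i}-\mathrm{I}_{\rho_i})\Big)\oplus\mathrm{O}_{r\times q},$$ where $J_i\in\mathbb{C}^{\eta_i\times\eta_i}$ is the upper Jordan block with eigenvalue $\lambda_i$ (ones on the superdiagonal), $N_{\rho_i}$ is the $\rho_i\times\rho_i$ matrix with ones on the superdiagonal and zeros elsewhere, $\mathrm{O}_{r\times q}$ is the zero matrix ($r,q\ge 0$), $\eta=\sum_i\eta_i$, $\rho=\sum_i\rho_i$, $m=\eta+\rho+r$, $n=\eta+\rho+q$. The $\lambda_i$ are the finite eigenvalues of the pencil. $\Gamma\subset\mathbb{C}$ is a positively oriented closed Jordan curve with interior $\Omega$, and no $\lambda_i$ ($1\le i\le\ell$) lies on $\Gamma$. The blocks are ordered so that $\lambda_1,\dots,\lambda_s\in\Omega$ and $\lambda_i\notin\Omega$ for $s<i\le\ell$. Put $t=\sum_{i=1}^s\eta_i$ and $J_\Omega=\bigoplus_{i=1}^sJ_i$. Here $\mathcal{R}$ denotes range, $^\perp$ orthogonal complement, $^\mathsf{H}$ conjugate transpose, and $\Pi_{\mathcal{S}}$ the orthogonal projector onto a subspace $\mathcal{S}$.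 Let $Q_\mathrm{s}\in\mathbb{C}^{n\times q}$ be the last $q$ columns of $Q$ and $P_\mathrm{s}\in\mathbb{C}^{r\times m}$ the last $r$ rows of $P$. For $1\le i\le\ell$ let $Q_i\in\mathbb{C}^{n\times\eta_i}$ and $P_i\in\mathbb{C}^{\eta_i\times m}$ be the consecutive column blocks of $Q$ and row blocks of $P$ corresponding to $z\mathrm{I}_{\eta_i}-J_i$. Set $\hat Q_i=\Pi_{\mathcal{R}(Q_\mathrm{s})^\perp}Q_i$, $\hat P_i=P_i\,\Pi_{\mathcal{R}(P_\mathrm{s}^\mathsf{H})^\perp}$, let $\hat Q_\Omega=[\hat Q_1,\dots,\hat Q_s]\in\mathbb{C}^{n\times t}$, and let $\hat P_\Omega\in\mathbb{C}^{t\times m}$ be $\hat P_1,\dots,\hat P_s$ stacked rowwise. Eigenvectors: an eigenvector of the pencil for $\lambda$ is a nonzero $\boldsymbol{x}\in\mathbb{C}^n$ with $A\boldsymbol{x}=\lambda B\boldsymbol{x}$; the first column of $Q_i$ is the right eigenvector corresponding to $\lambda_i$ ($1\le i\le\ell$), the remaining columns of $Q_i$ being generalized right eigenvectors. The complex moment matrices are $\mathsf{M}_k=\frac{1}{2\pi\mathrm{i}}\oint_\Gamma z^k(zB-A)^\dagger\,\mathrm{d}z\in\mathbb{C}^{n\times m}$, $k=0,1,\dots,M-1$, where $^\dagger$ is the Moore--Penrose pseudoinverse.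
   Formalization: The eigenvectors forming the columns of X_Ω are required to lie in the orthogonal complement of R(Q_s) (automatic if q=0; otherwise the inclusion can fail), and the Jordan curve Γ is taken piecewise continuously differentiable. *)

theory Defs
  imports
    "HOL-Complex_Analysis.Complex_Analysis"
    "Jordan_Normal_Form.Schur_Decomposition"
    "Jordan_Normal_Form.Jordan_Normal_Form"
    "Jordan_Normal_Form.DL_Rank"
begin

text \<open>Matrices are those of \<^theory>\<open>Jordan_Normal_Form.Matrix\<close>; dimensions may be 0.\<close>

abbreviation range_mat :: "complex mat \<Rightarrow> complex vec set"
  where "range_mat A \<equiv> vec_space.col_space (dim_row A) A"

definition orth_compl :: "nat \<Rightarrow> complex vec set \<Rightarrow> complex vec set"
  where "orth_compl n W = {x \<in> carrier_vec n. \<forall>y\<in>W. x \<bullet>c y = 0}"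

text \<open>The orthogonal projector of \<open>\<complex>\<^sup>n\<close> onto the subspace \<open>W\<close>: the Hermitian idempotent
  with range \<open>W\<close>.\<close>

definition orth_projector :: "nat \<Rightarrow> complex vec set \<Rightarrow> complex mat"
  where "orth_projector n W =
    (THE E. E \<in> carrier_mat n n \<and> E * E = E \<and> mat_adjoint E = E \<and> range_mat E = W)"

text \<open>The Moore--Penrose pseudoinverse, by the four Penrose equations.\<close>

definition pinv :: "complex mat \<Rightarrow> complex mat"
  where "pinv A = (THE X. X \<in> carrier_mat (dim_col A) (dim_row A)
    \<and> A * X * A = A \<and> X * A * X = X
    \<and> mat_adjoint (A * X) = A * X \<and> mat_adjoint (X * A) = X * A)"

text \<open>\<open>hcat n [M\<^sub>1, \<dots>, M\<^sub>k]\<close> is \<open>[M\<^sub>1, \<dots>, M\<^sub>k]\<close>, the blocks having \<open>n\<close> rows.\<close>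

definition hcat :: "nat \<Rightarrow> complex mat list \<Rightarrow> complex mat"
  where "hcat n Ms = mat_of_cols n (concat (map cols Ms))"

text \<open>Columns \<open>k, \<dots>, k + w - 1\<close> (counted from 0).\<close>

definition col_block :: "complex mat \<Rightarrow> nat \<Rightarrow> nat \<Rightarrow> complex mat"
  where "col_block Q k w = Matrix.mat (dim_row Q) w (\<lambda>(i, j). Q $$ (i, k + j))"

definition pencil :: "complex mat \<Rightarrow> complex mat \<Rightarrow> complex \<Rightarrow> complex mat"
  where "pencil A B z = z \<cdot>\<^sub>m B - A"

definition pencil_eigenvector :: "complex mat \<Rightarrow> complex mat \<Rightarrow> complex vec \<Rightarrow> complex \<Rightarrow> bool"
  where "pencil_eigenvector A B x \<mu> \<longleftrightarrow>
    x \<in> carrier_vec (dim_col A) \<and> x \<noteq> 0\<^sub>v (dim_col A) \<and> A *\<^sub>v x = \<mu> \<cdot>\<^sub>v (B *\<^sub>v x)"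

text \<open>In the Kronecker form, \<open>fb\<close> lists the pairs \<open>(\<eta>\<^sub>i, \<lambda>\<^sub>i)\<close> of the finite Jordan blocks and
  \<open>ib\<close> the sizes \<open>\<rho>\<^sub>i\<close> of the nilpotent blocks; both lists may be empty. Blocks are counted
  from 0. The block \<open>N\<^sub>\<rho>\<close> is the Jordan block with eigenvalue 0.\<close>

definition kronecker_form ::
    "(nat \<times> complex) list \<Rightarrow> nat list \<Rightarrow> nat \<Rightarrow> nat \<Rightarrow> complex \<Rightarrow> complex mat"
  where "kronecker_form fb ib r q z = diag_block_mat
     (map (\<lambda>(e, \<mu>). z \<cdot>\<^sub>m 1\<^sub>m e - jordan_block e \<mu>) fb
      @ map (\<lambda>k. z \<cdot>\<^sub>m jordan_block k 0 - 1\<^sub>m k) ib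
      @ [0\<^sub>m r q])"

definition kronecker_decomposition ::
    "nat \<Rightarrow> nat \<Rightarrow> complex mat \<Rightarrow> complex mat \<Rightarrow> complex mat \<Rightarrow> complex mat \<Rightarrow>
     (nat \<times> complex) list \<Rightarrow> nat list \<Rightarrow> nat \<Rightarrow> nat \<Rightarrow> bool"
  where "kronecker_decomposition m n A B P Q fb ib r q \<longleftrightarrow>
     A \<in> carrier_mat m n \<and> B \<in> carrier_mat m n
     \<and> P \<in> carrier_mat m m \<and> invertible_mat P
     \<and> Q \<in> carrier_mat n n \<and> invertible_mat Q
     \<and> (\<forall>(e, \<mu>)\<in>set fb. 0 < e) \<and> (\<forall>k\<in>set ib. 0 < k)
     \<and> m = sum_list (map fst fb) + sum_list ib + r
     \<and> n = sum_list (map fst fb) + sum_list ib + q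
     \<and> (\<forall>z. P * pencil A B z * Q = kronecker_form fb ib r q z)"

definition Q_sing :: "complex mat \<Rightarrow> nat \<Rightarrow> complex mat"
  where "Q_sing Q q = col_block Q (dim_col Q - q) q"

definition Q_fin :: "complex mat \<Rightarrow> (nat \<times> complex) list \<Rightarrow> nat \<Rightarrow> complex mat"
  where "Q_fin Q fb i = col_block Q (sum_list (map fst (take i fb))) (fst (fb ! i))"

definition Q_hat :: "complex mat \<Rightarrow> (nat \<times> complex) list \<Rightarrow> nat \<Rightarrow> nat \<Rightarrow> complex mat"
  where "Q_hat Q fb q i =
    orth_projector (dim_row Q) (orth_compl (dim_row Q) (range_mat (Q_sing Q q))) * Q_fin Q fb i"

definition Q_hat_Omega :: "complex mat \<Rightarrow> (nat \<times> complex) list \<Rightarrow> nat \<Rightarrow> nat \<Rightarrow> complex mat"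
  where "Q_hat_Omega Q fb q s = hcat (dim_row Q) (map (Q_hat Q fb q) [0..<s])"

text \<open>If \<open>q > 0\<close>, then for every \<open>\<lambda>\<close> the equation \<open>A x = \<lambda> B x\<close> determines \<open>x\<close> only up to the
  common kernel \<open>\<R>(Q\<^sub>s)\<close> of \<open>A\<close> and \<open>B\<close>. The eigenvectors collected in \<open>X\<^sub>\<Omega>\<close> are normalized to lie
  in \<open>\<R>(Q\<^sub>s)\<^sup>\<bottom>\<close>: for instance, the first column of \<open>\<Pi> Q\<^sub>i\<close>, which is the first column of \<open>Q\<^sub>i\<close>
  itself whenever the latter lies in \<open>\<R>(Q\<^sub>s)\<^sup>\<bottom>\<close> (always if \<open>q = 0\<close>). Since \<open>\<R>(\<Pi> Q\<^sub>i)\<close> is orthogonal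
  to \<open>\<R>(Q\<^sub>s)\<close>, no other eigenvector can lie in the range of the projected blocks. The columns
  of \<open>X\<close> are otherwise arbitrary, in any number.\<close>

definition eigenvectors_in_Omega ::
    "complex mat \<Rightarrow> complex mat \<Rightarrow> complex mat \<Rightarrow> (nat \<times> complex) list \<Rightarrow> nat \<Rightarrow> nat \<Rightarrow>
     complex mat \<Rightarrow> bool"
  where "eigenvectors_in_Omega A B Q fb q s X \<longleftrightarrow>
    dim_row X = dim_col A \<and>
    (\<forall>x\<in>set (cols X). (\<exists>i<s. pencil_eigenvector A B x (snd (fb ! i)))
       \<and> x \<in> orth_compl (dim_row Q) (range_mat (Q_sing Q q)))"

text \<open>A positively oriented closed Jordan curve, piecewise continuously differentiable so that
  the contour integrals of the library apply.\<close>

definition pos_jordan_curve :: "(real \<Rightarrow> complex) \<Rightarrow> bool"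
  where "pos_jordan_curve \<gamma> \<longleftrightarrow>
    valid_path \<gamma> \<and> simple_path \<gamma> \<and> pathfinish \<gamma> = pathstart \<gamma>
    \<and> (\<forall>z\<in>inside (path_image \<gamma>). winding_number \<gamma> z = 1)"

text \<open>The integral of a matrix-valued function is taken entrywise.\<close>

definition moment :: "(real \<Rightarrow> complex) \<Rightarrow> complex mat \<Rightarrow> complex mat \<Rightarrow> nat \<Rightarrow> complex mat"
  where "moment \<gamma> A B k = Matrix.mat (dim_col A) (dim_row A) (\<lambda>(i, j).
    1 / (2 * complex_of_real pi * \<i>) *
      contour_integral \<gamma> (\<lambda>z. z ^ k * pinv (pencil A B z) $$ (i, j)))"

end

(*
Off the finite eigenvalues, z B - A has the constant kernel R(Q_s) and the constant range
R(P_s^H)^perp. With E and F the orthogonal projectors onto R(Q_s)^perp and R(P_s^H)^perp, this gives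
  (z B - A)^+ = E Q R(z) P F,
where R(z) inverts the two regular diagonal blocks of the Kronecker form (eigenvalues in Omega;
the others together with the nilpotent blocks) and is zero elsewhere. The second block of R is
holomorphic on and inside the curve, so by Cauchy's theorem only the first t rows of the integral of
z^k R(z) survive, and every column of S lies in the range of the projected blocks E [Q_1, ..., Q_s].
These have full column rank t, because no nonzero combination of columns of Q_1, ..., Q_s lies in
R(Q_s). So rank S = t is equivalent to equality of the two ranges, and that range contains every
eigenvector for an eigenvalue in Omega that is orthogonal to R(Q_s). The explicit formula
M_k = Q_Omega J_Omega^k P_Omega is not needed.
*)
theory Submission
  imports Defs
begin

unbundle no vec_syntax
unbundle no inner_syntax
no_notation fps_nth (infixl "$" 75)

section \<open>Ranges and ranks\<close>

lemma mult_mat_unit_vec: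
  assumes "(A :: complex mat) \<in> carrier_mat m n" "j < n"
  shows "A *\<^sub>v unit_vec n j = col A j"
  using assms by (intro eq_vecI) auto

lemma range_mat_eq:
  assumes "A \<in> carrier_mat n k"
  shows "range_mat A = {A *\<^sub>v x | x. x \<in> carrier_vec k}"
proof -
  have d: "dim_row A = n" "dim_col A = k" using assms by auto
  have eq: "vec_space.col_space n A = {y \<in> carrier_vec n. \<exists>x\<in>carrier_vec k. A *\<^sub>v x = y}"
    using vec_space.col_space_eq[OF assms] unfolding d .
  have "A *\<^sub>v x \<in> carrier_vec n" if "x \<in> carrier_vec k" for x
    using assms that by (rule mult_mat_vec_carrier)
  then show ?thesis unfolding d eq by blast
qed

lemma range_mat_subsetI:
  assumes S: "S \<in> carrier_mat n k" and G: "G \<in> carrier_mat n t"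
    and cols: "\<And>j. j < k \<Longrightarrow> col S j \<in> range_mat G"
  shows "range_mat S \<subseteq> range_mat G"
proof -
  interpret vec_space "TYPE(complex)" n .
  have d: "dim_row G = n" "dim_row S = n" using S G by auto
  have "set (cols S) \<subseteq> span (set (cols G))"
  proof
    fix x assume "x \<in> set (cols S)"
    then obtain j where "j < k" "x = col S j" using S by (auto simp: in_set_conv_nth)
    then show "x \<in> span (set (cols G))" using cols d by (simp add: col_space_def)
  qed
  moreover have "set (cols G) \<subseteq> carrier_vec n" using G cols_dim by blast
  ultimately show ?thesis unfolding d col_space_def by (intro span_subsetI)
qed

text \<open>\<open>lin_indpt\<close> speaks of the set of columns, so repetitions have to be
  excluded first: equal columns \<open>i\<close> and \<open>j\<close> would put a difference of two
  unit vectors into the kernel.\<close>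

lemma rank_injective:
  assumes G: "G \<in> carrier_mat n t"
    and inj: "\<And>u. u \<in> carrier_vec t \<Longrightarrow> G *\<^sub>v u = 0\<^sub>v n \<Longrightarrow> u = 0\<^sub>v t"
  shows "vec_space.rank n (G :: complex mat) = t"
proof -
  interpret vec_space "TYPE(complex)" n .
  have dist: "distinct (cols G)"
    unfolding distinct_conv_nth
  proof (intro allI impI)
    fix i j assume ij: "i < length (cols G)" "j < length (cols G)" "i \<noteq> j"
    then have ij': "i < t" "j < t" using G by auto
    show "cols G ! i \<noteq> cols G ! j"
    proof
      assume "cols G ! i = cols G ! j"
      then have "col G i = col G j" using ij by auto
      then have "G *\<^sub>v unit_vec t i = G *\<^sub>v unit_vec t j"
        using G ij' by (simp add: mult_mat_unit_vec[of _ n t])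
      then have "G *\<^sub>v (unit_vec t i - unit_vec t j) = 0\<^sub>v n"
        using G by (subst mult_minus_distrib_mat_vec[of _ n t]) auto
      then have "unit_vec t i - unit_vec t j = (0\<^sub>v t :: complex vec)" by (intro inj) auto
      then have "(unit_vec t i - unit_vec t j :: complex vec) $ i = 0" using ij' by simp
      then show False using ij' ij(3) by simp
    qed
  qed
  have "lin_indpt (set (cols G))"
    using lin_depE[OF G _ dist] inj by metis
  then show ?thesis using lin_indpt_full_rank[OF G dist] by blast
qed

text \<open>If \<open>S\<close> has rank \<open>t\<close>, then \<open>t\<close> independent columns
  of \<open>S\<close> lie in the \<open>t\<close>-dimensional range of \<open>G\<close> and form a
  basis of it. Conversely, the rank is the dimension of the range.\<close>

lemma rank_eq_iff_range_eq:
  assumes S: "S \<in> carrier_mat n k" and G: "G \<in> carrier_mat n t"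
    and rk: "vec_space.rank n G = t" and sub: "range_mat S \<subseteq> range_mat G"
  shows "vec_space.rank n S = t \<longleftrightarrow> range_mat G = range_mat S"
proof -
  interpret vec_space "TYPE(complex)" n .
  let ?W = "span (set (cols G))"
  have SC: "set (cols S) \<subseteq> carrier_vec n" and GC: "set (cols G) \<subseteq> carrier_vec n"
    using S G cols_dim by blast+
  have rS: "range_mat S = span (set (cols S))" and rG: "range_mat G = ?W"
    using carrier_matD(1)[OF S] carrier_matD(1)[OF G] by (simp_all only: col_space_def)
  show ?thesis
  proof
    assume rkS: "rank S = t"
    \<comment> \<open>The empty set is the starting point for a maximal independent set of columns
      of \<open>S\<close>, whose cardinality is the rank.\<close>
    have "lin_indpt {}" unfolding lin_dep_def by auto
    then obtain U where U: "maximal U (\<lambda>T. T \<subseteq> set (cols S) \<and> lin_indpt T)" "finite U"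
      using maximal_exists_superset[of "set (cols S)" "\<lambda>T. T \<subseteq> set (cols S) \<and> lin_indpt T" "{}"]
      by auto
    have cU: "card U = t" using rank_card_indpt[OF S U(1)] rkS by simp
    have US: "U \<subseteq> set (cols S)" and li: "lin_indpt U" using U(1) unfolding maximal_def by auto
    have "U \<subseteq> span (set (cols S))" using US in_own_span[of "set (cols S)"] SC by simp
    then have UW: "U \<subseteq> ?W" using sub unfolding rS rG by blast
    \<comment> \<open>From here on the ambient space is the range of \<open>G\<close> itself, so
      that a dimension count turns \<open>U\<close> into a basis.\<close>
    have subm: "submodule class_ring ?W V" using GC by (simp add: span_is_submodule)
    have subs: "subspace class_ring ?W V" using GC by (simp add: span_is_subspace)
    have vs: "vectorspace class_ring (vs ?W)" using subs subspace_is_vs by blast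
    have fd: "vectorspace.fin_dim class_ring (vs ?W)" using fin_dim_span_cols[OF G] .
    have "LinearCombinations.module.lin_indpt class_ring (vs ?W) U"
      using li span_li_not_depend(2)[OF UW subm] by blast
    moreover have "vectorspace.dim class_ring (vs ?W) \<le> card U"
      using rk cU by (simp only: rank_def)
    moreover have "U \<subseteq> carrier (vs ?W)" using UW by simp
    ultimately have "vectorspace.basis class_ring (vs ?W) U"
      using vectorspace.dim_li_is_basis[OF vs fd U(2)] by blast
    then have "LinearCombinations.module.span class_ring (vs ?W) U = ?W"
      using vectorspace.basis_def[OF vs] carrier_vs_is_self by blast
    then have "span U = ?W" unfolding span_li_not_depend(1)[OF UW subm] .
    then have "?W \<subseteq> span (set (cols S))" using span_is_monotone[OF US] by blast
    then show "range_mat G = range_mat S" using sub unfolding rS rG by blast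
  next
    assume "range_mat G = range_mat S"
    then show "rank S = t" using rk unfolding rank_def rS rG by (simp only:)
  qed
qed

section \<open>Orthogonal projectors and the pseudoinverse\<close>

lemma mat_adjoint_carrier [simp]:
  "A \<in> carrier_mat m n \<Longrightarrow> mat_adjoint A \<in> carrier_mat n m"
  by (auto simp: mat_adjoint_def)

lemma mat_adjoint_index [simp]:
  "i < dim_col A \<Longrightarrow> j < dim_row A \<Longrightarrow> mat_adjoint A $$ (i, j) = conjugate (A $$ (j, i))"
  by (simp add: mat_adjoint_def mat_of_rows_index)

lemma mat_adjoint_dim [simp]:
  "dim_row (mat_adjoint A) = dim_col A" "dim_col (mat_adjoint A) = dim_row A"
  by (auto simp: mat_adjoint_def)

lemma mat_adjoint_mult:
  assumes "A \<in> carrier_mat m n" "B \<in> carrier_mat n k"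
  shows "mat_adjoint (A * B) = mat_adjoint B * mat_adjoint (A :: complex mat)"
  using assms by (intro eq_matI) (auto simp: scalar_prod_def mult.commute)

lemma mat_adjoint_adjoint [simp]: "mat_adjoint (mat_adjoint A) = (A :: complex mat)"
  by (intro eq_matI) auto

lemma mat_adjoint_one [simp]: "mat_adjoint (1\<^sub>m n) = (1\<^sub>m n :: complex mat)"
  by (intro eq_matI) auto

lemma mat_adjoint_minus:
  assumes "A \<in> carrier_mat m n" "B \<in> carrier_mat m n"
  shows "mat_adjoint (A - B) = mat_adjoint A - mat_adjoint (B :: complex mat)"
  using assms by (intro eq_matI) auto

lemma mult_vec_inner_adjoint:
  assumes "A \<in> carrier_mat m n" "x \<in> carrier_vec n" "y \<in> carrier_vec m"
  shows "(A *\<^sub>v x) \<bullet>c y = x \<bullet>c (mat_adjoint (A :: complex mat) *\<^sub>v y)"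
proof -
  have "(A *\<^sub>v x) \<bullet>c y = (\<Sum>i<m. \<Sum>j<n. A $$ (i, j) * x $ j * cnj (y $ i))"
    using assms by (simp add: scalar_prod_def sum_distrib_right atLeast0LessThan)
  also have "\<dots> = (\<Sum>j<n. \<Sum>i<m. A $$ (i, j) * x $ j * cnj (y $ i))"
    by (rule sum.swap)
  also have "\<dots> = x \<bullet>c (mat_adjoint A *\<^sub>v y)"
    using assms by (simp add: scalar_prod_def sum_distrib_left atLeast0LessThan mult_ac)
  finally show ?thesis .
qed

text \<open>The inverse is written out by the adjugate because its entries must later be recognised
  as holomorphic functions of the pencil parameter.\<close>

lemma det_nonzero_inverse:
  assumes A: "A \<in> carrier_mat n n" and "Determinant.det A \<noteq> (0 :: complex)"
  defines "R \<equiv> inverse (Determinant.det A) \<cdot>\<^sub>m adj_mat A"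
  shows "R \<in> carrier_mat n n" "A * R = 1\<^sub>m n" "R * A = 1\<^sub>m n"
proof -
  let ?d = "Determinant.det A"
  note adj = adj_mat[OF A]
  have smult: "inverse ?d \<cdot>\<^sub>m (?d \<cdot>\<^sub>m 1\<^sub>m n) = 1\<^sub>m n"
    using assms(2) by (intro eq_matI) auto
  show "R \<in> carrier_mat n n" using adj by (simp add: R_def)
  show "A * R = 1\<^sub>m n"
    unfolding R_def using smult adj by (simp add: mult_smult_distrib[OF A])
  show "R * A = 1\<^sub>m n"
    unfolding R_def using smult adj A by (simp add: mult_smult_assoc_mat[of _ n n _ n])
qed

text \<open>A kernel vector \<open>v\<close> of the Gram matrix makes the squared norm of
  \<open>C *\<^sub>v v\<close> zero, so injectivity of \<open>C\<close> applies to it.\<close>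

lemma gram_det_nonzero:
  assumes C: "(C :: complex mat) \<in> carrier_mat n q"
    and inj: "\<And>u. u \<in> carrier_vec q \<Longrightarrow> C *\<^sub>v u = 0\<^sub>v n \<Longrightarrow> u = 0\<^sub>v q"
  shows "Determinant.det (mat_adjoint C * C) \<noteq> 0"
proof
  have CC: "mat_adjoint C * C \<in> carrier_mat q q" using C by auto
  assume "Determinant.det (mat_adjoint C * C) = 0"
  then obtain v where v: "v \<in> carrier_vec q" "v \<noteq> 0\<^sub>v q" "(mat_adjoint C * C) *\<^sub>v v = 0\<^sub>v q"
    using det_0_iff_vec_prod_zero[OF CC] by blast
  have "(C *\<^sub>v v) \<bullet>c (C *\<^sub>v v) = v \<bullet>c (mat_adjoint C *\<^sub>v (C *\<^sub>v v))"
    using C v by (intro mult_vec_inner_adjoint) auto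
  also have "\<dots> = 0" using C v by (simp add: assoc_mult_mat_vec[of _ q n _ q, symmetric])
  finally have "C *\<^sub>v v = 0\<^sub>v n" using C v conjugate_square_eq_0_vec[of "C *\<^sub>v v" n] by auto
  then show False using inj v by blast
qed

text \<open>The projector is I - C (C^H C)^(-1) C^H. The factor \<open>Y\<close> is handed out as
  well: if \<open>T * C\<close> is zero, the form \<open>1\<^sub>m n - C * Y\<close> gives
  \<open>T * E = T\<close> at once.\<close>

lemma orth_projector_exists:
  assumes C: "(C :: complex mat) \<in> carrier_mat n q"
    and inj: "\<And>u. u \<in> carrier_vec q \<Longrightarrow> C *\<^sub>v u = 0\<^sub>v n \<Longrightarrow> u = 0\<^sub>v q"
  obtains E Y where "E \<in> carrier_mat n n" "E * E = E" "mat_adjoint E = E"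
    "range_mat E = orth_compl n (range_mat C)" "Y \<in> carrier_mat q n" "E = 1\<^sub>m n - C * Y"
    "E * C = 0\<^sub>m n q"
proof -
  let ?H = "mat_adjoint C"
  have H: "?H \<in> carrier_mat q n" using C by simp
  have HC: "?H * C \<in> carrier_mat q q" using C by auto
  obtain R where R: "R \<in> carrier_mat q q" "?H * C * R = 1\<^sub>m q" "R * (?H * C) = 1\<^sub>m q"
    using det_nonzero_inverse[OF HC gram_det_nonzero[OF C inj]] by blast
  have adjHC: "mat_adjoint (?H * C) = ?H * C"
    using C by (subst mat_adjoint_mult[of _ q n _ q]) auto
  \<comment> \<open>The inverse of a Hermitian matrix is Hermitian: the adjoint of \<open>R\<close>
    is a left inverse of the Gram matrix, and \<open>R\<close> is a right inverse.\<close>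
  have adjR: "mat_adjoint R = R"
  proof -
    have "mat_adjoint R * (?H * C) = 1\<^sub>m q"
      using arg_cong[OF R(2), of mat_adjoint] R(1) HC adjHC
      by (subst (asm) mat_adjoint_mult[of _ q q _ q]) auto
    then have "mat_adjoint R * (?H * C) * R = R" using R by simp
    moreover have "mat_adjoint R * (?H * C) * R = mat_adjoint R * (?H * C * R)"
      using R HC by (intro assoc_mult_mat) auto
    ultimately show ?thesis using R by simp
  qed
  define Y where "Y = R * ?H"
  define E where "E = 1\<^sub>m n - C * Y"
  have Y: "Y \<in> carrier_mat q n" using R H by (auto simp: Y_def)
  have CY: "C * Y \<in> carrier_mat n n" using C Y by auto
  have E: "E \<in> carrier_mat n n" unfolding E_def using CY by (rule minus_carrier_mat)
  have YC: "Y * C = 1\<^sub>m q" unfolding Y_def using R H C by (simp add: assoc_mult_mat[of _ q q _ n _ q])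
  have EC: "E * C = 0\<^sub>m n q"
  proof -
    have "E * C = C - C * Y * C"
      unfolding E_def using C CY by (subst minus_mult_distrib_mat[of _ n n _ _ q]) auto
    also have "C * Y * C = C" using C Y YC by (subst assoc_mult_mat[of _ n q _ n _ q]) auto
    finally show ?thesis using C by auto
  qed
  have EE: "E * E = E"
  proof -
    have "E * E = E * 1\<^sub>m n - E * (C * Y)"
      unfolding E_def[symmetric] using E CY
      by (subst (2) E_def, subst mult_minus_distrib_mat[of _ n n _ n]) auto
    also have "E * (C * Y) = 0\<^sub>m n n"
      using E C Y EC by (subst assoc_mult_mat[of _ n n _ q _ n, symmetric]) auto
    finally show ?thesis using E by auto
  qed
  have adjE: "mat_adjoint E = E"
  proof -
    have "mat_adjoint (C * Y) = C * Y"
      unfolding Y_def using C R H adjR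
      by (simp add: mat_adjoint_mult[of _ n q _ n] mat_adjoint_mult[of _ q q _ n]
          assoc_mult_mat[of _ n q _ q _ n])
    then show ?thesis unfolding E_def using CY by (simp add: mat_adjoint_minus[of _ n n])
  qed
  have HE: "?H * E = 0\<^sub>m q n"
    using arg_cong[OF EC, of mat_adjoint] E C adjE
    by (subst (asm) mat_adjoint_mult[of _ n n _ q]) auto
  have "range_mat E = orth_compl n (range_mat C)"
  proof (intro equalityI subsetI)
    fix x assume "x \<in> range_mat E"
    then obtain u where u: "u \<in> carrier_vec n" "x = E *\<^sub>v u" using range_mat_eq[OF E] by auto
    have "x \<bullet>c (C *\<^sub>v w) = 0" if w: "w \<in> carrier_vec q" for w
    proof -
      have 1: "x \<bullet>c (C *\<^sub>v w) = u \<bullet>c (mat_adjoint E *\<^sub>v (C *\<^sub>v w))"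
        unfolding u(2) using E C w u by (intro mult_vec_inner_adjoint) auto
      have "mat_adjoint E *\<^sub>v (C *\<^sub>v w) = E * C *\<^sub>v w"
        unfolding adjE using E C w by (simp add: assoc_mult_mat_vec[of _ n n _ q])
      also have "\<dots> = 0\<^sub>v n" using w unfolding EC by (intro eq_vecI) auto
      finally show ?thesis using 1 u by simp
    qed
    then show "x \<in> orth_compl n (range_mat C)"
      unfolding orth_compl_def range_mat_eq[OF C] using u E by auto
  next
    fix x assume x: "x \<in> orth_compl n (range_mat C)"
    then have xc: "x \<in> carrier_vec n" by (simp add: orth_compl_def)
    \<comment> \<open>The squared norm of C^H x is the inner product of C C^H x with x, which
      vanishes for \<open>x\<close> orthogonal to the range of \<open>C\<close>. Hence
      \<open>C * Y\<close> annihilates \<open>x\<close>, and \<open>E\<close> fixes it.\<close>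
    let ?w = "?H *\<^sub>v x"
    have w: "?w \<in> carrier_vec q" using H xc by auto
    have "(C *\<^sub>v ?w) \<bullet>c x = ?w \<bullet>c ?w" using C w xc by (intro mult_vec_inner_adjoint) auto
    moreover have "x \<bullet>c (C *\<^sub>v ?w) = 0"
      using x w unfolding orth_compl_def range_mat_eq[OF C] by blast
    then have "(C *\<^sub>v ?w) \<bullet>c x = 0"
      using C w xc by (metis conjugate_complex_def complex_cnj_zero conjugate_vec_sprod_comm
          conjugate_sprod_vec conjugate_id mult_mat_vec_carrier carrier_vec_conjugate)
    ultimately have "?w = 0\<^sub>v q" using w conjugate_square_eq_0_vec[of ?w q] by auto
    moreover have "R *\<^sub>v 0\<^sub>v q = 0\<^sub>v q" "C *\<^sub>v 0\<^sub>v q = 0\<^sub>v n"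
      using R C by (auto)
    ultimately have "C * Y *\<^sub>v x = 0\<^sub>v n"
      unfolding Y_def using C R H xc
      by (simp add: assoc_mult_mat_vec[of _ n q _ n] assoc_mult_mat_vec[of _ q q _ n])
    then have "E *\<^sub>v x = x" unfolding E_def using CY xc
      by (subst minus_mult_distrib_mat_vec[of _ n n]) auto
    then show "x \<in> range_mat E" using range_mat_eq[OF E] xc by force
  qed
  then show thesis using that[OF E EE adjE _ Y E_def EC] by blast
qed

text \<open>Equal ranges make each idempotent fix the columns of the other. The adjoint of
  \<open>E' * E = E\<close> reads \<open>E * E' = E\<close>, to be compared with
  \<open>E * E' = E'\<close>.\<close>

lemma hermitian_idempotent_unique:
  assumes "E \<in> carrier_mat n n" "E * E = E" "mat_adjoint E = E"
    and "E' \<in> carrier_mat n n" "E' * E' = E'" "mat_adjoint E' = E'"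
    and "range_mat E = range_mat E'"
  shows "E = (E' :: complex mat)"
proof -
  have absorb: "G * F = F"
    if G: "G \<in> carrier_mat n n" "G * G = G" and F: "F \<in> carrier_mat n n"
      and sub: "range_mat F = range_mat G" for F G :: "complex mat"
  proof (rule eq_matI)
    fix i j assume ij: "i < dim_row F" "j < dim_col F"
    then have "F *\<^sub>v unit_vec n j \<in> range_mat G"
      using range_mat_eq[OF F] sub F unit_vec_carrier[of n j] by blast
    then obtain u where u: "u \<in> carrier_vec n" "F *\<^sub>v unit_vec n j = G *\<^sub>v u"
      using range_mat_eq[OF G(1)] by auto
    have "G *\<^sub>v (G *\<^sub>v u) = G *\<^sub>v u" using G u by (simp add: assoc_mult_mat_vec[of _ n n _ n, symmetric])
    then have "G *\<^sub>v col F j = col F j" using u F ij by (simp add: mult_mat_unit_vec[of _ n n])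
    then have "(G *\<^sub>v col F j) $ i = F $$ (i, j)" using ij by simp
    then show "(G * F) $$ (i, j) = F $$ (i, j)" using ij F G by simp
  qed (use G F in auto)
  have "E' * E = E" "E * E' = E'" using assms absorb by blast+
  then show ?thesis using assms mat_adjoint_mult[of E' n n E n] by simp
qed

lemma orth_projector_eq:
  assumes "E \<in> carrier_mat n n" "E * E = E" "mat_adjoint E = E" "range_mat E = W"
  shows "orth_projector n W = E"
  unfolding orth_projector_def
  by (rule the_equality) (use assms hermitian_idempotent_unique in blast)+

text \<open>For two solutions \<open>Y\<close> and \<open>Z\<close> the Hermitian conditions give
  \<open>A * Y = A * Z\<close> and \<open>Y * A = Z * A\<close>, whence \<open>Y\<close>,
  \<open>Z * A * Y\<close> and \<open>Z\<close> coincide.\<close>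

lemma pinv_eq:
  assumes A: "A \<in> carrier_mat m n" and X: "X \<in> carrier_mat n m"
    and "A * X * A = A" "X * A * X = X"
    and "mat_adjoint (A * X) = A * X" "mat_adjoint (X * A) = X * A"
  shows "pinv A = X"
proof -
  have uniq: "Y = Z"
    if Y: "Y \<in> carrier_mat n m" "A * Y * A = A" "Y * A * Y = Y"
        "mat_adjoint (A * Y) = A * Y" "mat_adjoint (Y * A) = Y * A"
      and Z: "Z \<in> carrier_mat n m" "A * Z * A = A" "Z * A * Z = Z"
        "mat_adjoint (A * Z) = A * Z" "mat_adjoint (Z * A) = Z * A" for Y Z
  proof -
    have c: "A * Y \<in> carrier_mat m m" "A * Z \<in> carrier_mat m m"
      "Y * A \<in> carrier_mat n n" "Z * A \<in> carrier_mat n n" using A Y(1) Z(1) by auto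
    have 1: "A * F * (A * G) = A * G" "G * A * (F * A) = G * A"
      if F: "F \<in> carrier_mat n m" "A * F * A = A" and G: "G \<in> carrier_mat n m" for F G
    proof -
      have "A * F * (A * G) = A * F * A * G"
        using A F G by (intro assoc_mult_mat[symmetric]) auto
      then show "A * F * (A * G) = A * G" using F by simp
      have "G * A * (F * A) = G * (A * (F * A))" using A F G by (intro assoc_mult_mat) auto
      also have "A * (F * A) = A * F * A" using A F G by (intro assoc_mult_mat[symmetric]) auto
      finally show "G * A * (F * A) = G * A" using F by simp
    qed
    have 3: "A * Y = A * Z"
      using 1(1)[OF Y(1,2) Z(1)] 1(1)[OF Z(1,2) Y(1)] Y(4) Z(4) mat_adjoint_mult[OF c(2) c(1)]
      by simp
    have 4: "Y * A = Z * A"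
      using 1(2)[OF Y(1,2) Z(1)] 1(2)[OF Z(1,2) Y(1)] Y(5) Z(5) mat_adjoint_mult[OF c(3) c(4)]
      by simp
    have "Y = Z * A * Y" using Y 4 by simp
    also have "\<dots> = Z * (A * Y)" using A Y Z by (intro assoc_mult_mat) auto
    also have "\<dots> = Z * A * Z" unfolding 3 using A Z by (intro assoc_mult_mat[symmetric]) auto
    finally show ?thesis using Z by simp
  qed
  have d: "dim_row A = m" "dim_col A = n" using A by auto
  show ?thesis unfolding pinv_def d
  proof (rule the_equality)
    fix Y assume "Y \<in> carrier_mat n m \<and> A * Y * A = A \<and> Y * A * Y = Y
      \<and> mat_adjoint (A * Y) = A * Y \<and> mat_adjoint (Y * A) = Y * A"
    then show "Y = X" using assms uniq[of Y X] by blast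
  qed (intro conjI; fact)
qed

section \<open>Block diagonal matrices and their inverses\<close>

text \<open>The blocks may be rectangular or empty, so that the singular block of the Kronecker form
  fits in. The shape is that of one recursion step of \<open>diag_block_mat\<close>.\<close>

definition block_diag :: "complex mat \<Rightarrow> complex mat \<Rightarrow> complex mat"
  where "block_diag A B =
    four_block_mat A (0\<^sub>m (dim_row A) (dim_col B)) (0\<^sub>m (dim_row B) (dim_col A)) B"

lemma block_diag_carrier [simp]:
  "A \<in> carrier_mat a b \<Longrightarrow> B \<in> carrier_mat c d \<Longrightarrow> block_diag A B \<in> carrier_mat (a + c) (b + d)"
  by (auto simp: block_diag_def)

lemma block_diag_dim [simp]:
  "dim_row (block_diag A B) = dim_row A + dim_row B"
  "dim_col (block_diag A B) = dim_col A + dim_col B"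
  by (auto simp: block_diag_def)

lemma block_diag_index:
  "i < dim_row A + dim_row B \<Longrightarrow> j < dim_col A + dim_col B \<Longrightarrow> block_diag A B $$ (i, j) =
    (if i < dim_row A then (if j < dim_col A then A $$ (i, j) else 0)
     else (if j < dim_col A then 0 else B $$ (i - dim_row A, j - dim_col A)))"
  by (auto simp: block_diag_def)

lemma block_diag_mult:
  assumes "A \<in> carrier_mat a b" "B \<in> carrier_mat c d" "C \<in> carrier_mat b e" "D \<in> carrier_mat d f"
  shows "block_diag A B * block_diag C D = block_diag (A * C) (B * D)"
  unfolding block_diag_def
  using assms by (subst mult_four_block_mat[of _ a b _ d _ c _ _ e _ f]) auto

lemma diag_block_mat_append_block_diag:
  "diag_block_mat (As @ Bs) = block_diag (diag_block_mat As) (diag_block_mat Bs)"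
  by (simp add: diag_block_mat_append block_diag_def Let_def)

text \<open>The right factor only erases the last \<open>q\<close> columns, and these vanish
  already.\<close>

lemma mult_block_diag_one_zero:
  assumes "B \<in> carrier_mat m (k + q)" and "\<And>i j. i < m \<Longrightarrow> k \<le> j \<Longrightarrow> j < k + q \<Longrightarrow> B $$ (i, j) = 0"
  shows "B * block_diag (1\<^sub>m k) (0\<^sub>m q q) = B"
proof (rule eq_matI)
  fix i j assume "i < dim_row B" "j < dim_col B"
  then have ij: "i < m" "j < k + q" using assms(1) by auto
  have "(B * block_diag (1\<^sub>m k) (0\<^sub>m q q)) $$ (i, j)
      = (\<Sum>l = 0..<k + q. B $$ (i, l) * block_diag (1\<^sub>m k) (0\<^sub>m q q) $$ (l, j))"
    using ij assms(1) by (simp add: scalar_prod_def)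
  also have "\<dots> = (\<Sum>l = 0..<k + q. if l = j then B $$ (i, j) else 0)"
    using ij assms by (intro sum.cong) (auto simp: block_diag_index)
  also have "\<dots> = B $$ (i, j)" using ij by simp
  finally show "(B * block_diag (1\<^sub>m k) (0\<^sub>m q q)) $$ (i, j) = B $$ (i, j)" .
qed (use assms(1) in auto)

text \<open>This class contains both kinds of regular Kronecker blocks, is closed under block
  diagonal sums, and admits inverses holomorphic off \<open>\<Lambda>\<close>.\<close>

definition regular_off :: "complex set \<Rightarrow> nat \<Rightarrow> (complex \<Rightarrow> complex mat) \<Rightarrow> bool"
  where "regular_off \<Lambda> n F \<longleftrightarrow> (\<forall>z. F z \<in> carrier_mat n n)
    \<and> (\<forall>i<n. \<forall>j<n. (\<lambda>z. F z $$ (i, j)) holomorphic_on UNIV)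
    \<and> (\<forall>z. z \<notin> \<Lambda> \<longrightarrow> Determinant.det (F z) \<noteq> 0)"

text \<open>The block is upper triangular with every diagonal entry equal to
  \<open>z - \<mu>\<close>, hence singular only at the eigenvalue.\<close>

lemma regular_off_jordan:
  assumes "\<mu> \<in> \<Lambda>"
  shows "regular_off \<Lambda> e (\<lambda>z. z \<cdot>\<^sub>m 1\<^sub>m e - jordan_block e \<mu>)"
proof -
  have "Determinant.det (z \<cdot>\<^sub>m 1\<^sub>m e - jordan_block e \<mu>) \<noteq> 0" if "z \<notin> \<Lambda>" for z
  proof -
    have "upper_triangular (z \<cdot>\<^sub>m 1\<^sub>m e - jordan_block e \<mu>)"
      unfolding upper_triangular_def by auto
    moreover have "0 \<notin> set (diag_mat (z \<cdot>\<^sub>m 1\<^sub>m e - jordan_block e \<mu>))"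
      using that assms by (auto simp: diag_mat_def)
    ultimately show ?thesis
      using upper_triangular_imp_det_eq_0_iff[of "z \<cdot>\<^sub>m 1\<^sub>m e - jordan_block e \<mu>" e]
      by (simp add: minus_carrier_mat)
  qed
  moreover have "(\<lambda>z. (z \<cdot>\<^sub>m 1\<^sub>m e - jordan_block e \<mu>) $$ (i, j)) holomorphic_on UNIV"
    if "i < e" "j < e" for i j
    using that by (auto intro!: holomorphic_intros)
  ultimately show ?thesis unfolding regular_off_def by (auto intro!: minus_carrier_mat)
qed

text \<open>The block is upper triangular with diagonal entries -1, so infinite eigenvalues
  contribute no exceptional points.\<close>

lemma regular_off_nilpotent:
  "regular_off \<Lambda> e (\<lambda>z. z \<cdot>\<^sub>m jordan_block e 0 - 1\<^sub>m e)"
proof -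
  have "Determinant.det (z \<cdot>\<^sub>m jordan_block e 0 - 1\<^sub>m e) \<noteq> 0" for z :: complex
  proof -
    have "upper_triangular (z \<cdot>\<^sub>m jordan_block e 0 - 1\<^sub>m e)"
      unfolding upper_triangular_def by auto
    moreover have "0 \<notin> set (diag_mat (z \<cdot>\<^sub>m jordan_block e 0 - 1\<^sub>m e))"
      by (auto simp: diag_mat_def)
    ultimately show ?thesis
      using upper_triangular_imp_det_eq_0_iff[of "z \<cdot>\<^sub>m jordan_block e 0 - 1\<^sub>m e" e]
      by (simp add: minus_carrier_mat)
  qed
  moreover have "(\<lambda>z. (z \<cdot>\<^sub>m jordan_block e 0 - 1\<^sub>m e) $$ (i, j)) holomorphic_on UNIV"
    if "i < e" "j < e" for i j
    using that by (auto intro!: holomorphic_intros)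
  ultimately show ?thesis unfolding regular_off_def by (auto intro!: minus_carrier_mat)
qed

lemma regular_off_block_diag:
  assumes F: "regular_off \<Lambda> n F" and G: "regular_off \<Lambda> k G"
  shows "regular_off \<Lambda> (n + k) (\<lambda>z. block_diag (F z) (G z))"
proof -
  have c: "F z \<in> carrier_mat n n" "G z \<in> carrier_mat k k" for z
    using F G by (auto simp: regular_off_def)
  have d: "dim_row (F z) = n" "dim_col (F z) = n" "dim_row (G z) = k" "dim_col (G z) = k" for z
    using c[of z] by auto
  have "Determinant.det (block_diag (F z) (G z)) = Determinant.det (F z) * Determinant.det (G z)" for z
    unfolding block_diag_def d
    by (rule det_four_block_mat_lower_left_zero[OF c(1) _ _ c(2)]) auto
  moreover have "(\<lambda>z. block_diag (F z) (G z) $$ (i, j)) holomorphic_on UNIV"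
    if "i < n + k" "j < n + k" for i j
    using F G that unfolding regular_off_def
    by (cases "i < n"; cases "j < n") (auto simp: block_diag_index d)
  ultimately show ?thesis
    using F G c unfolding regular_off_def by simp
qed

lemma regular_off_diag_block_mat:
  assumes "\<And>e F. (e, F) \<in> set L \<Longrightarrow> regular_off \<Lambda> e F"
  shows "regular_off \<Lambda> (sum_list (map fst L)) (\<lambda>z. diag_block_mat (map (\<lambda>(e, F). F z) L))"
  using assms
proof (induction L)
  case Nil
  then show ?case by (simp add: regular_off_def)
next
  case (Cons a L)
  obtain e F where a: "a = (e, F)" by force
  have "regular_off \<Lambda> (e + sum_list (map fst L))
      (\<lambda>z. block_diag (F z) (diag_block_mat (map (\<lambda>(e, F). F z) L)))"
    using Cons a by (intro regular_off_block_diag) auto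
  then show ?case by (simp add: a block_diag_def Let_def)
qed

text \<open>By the Leibniz formula the determinant is a polynomial in the entries.\<close>

lemma holomorphic_on_det:
  assumes "\<And>z. F z \<in> carrier_mat n n"
    and "\<And>i j. i < n \<Longrightarrow> j < n \<Longrightarrow> (\<lambda>z. F z $$ (i, j)) holomorphic_on S"
  shows "(\<lambda>z. Determinant.det (F z) :: complex) holomorphic_on S"
proof -
  have "(\<lambda>z. \<Sum>p | p permutes {0..<n}. signof p * (\<Prod>i = 0..<n. F z $$ (i, p i))) holomorphic_on S"
    by (intro holomorphic_intros assms(2)) (auto dest: permutes_in_image)
  then show ?thesis by (simp add: det_def'[OF assms(1)])
qed

text \<open>Cramer's rule: the cofactors are determinants of holomorphic matrix functions, and the
  determinant dividing them has no zero off \<open>\<Lambda>\<close>.\<close>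

lemma regular_off_inverse:
  assumes F: "regular_off \<Lambda> n F"
  obtains R where "\<And>z. R z \<in> carrier_mat n n"
    and "\<And>z. z \<notin> \<Lambda> \<Longrightarrow> F z * R z = 1\<^sub>m n" and "\<And>z. z \<notin> \<Lambda> \<Longrightarrow> R z * F z = 1\<^sub>m n"
    and "\<And>i j. i < n \<Longrightarrow> j < n \<Longrightarrow> (\<lambda>z. R z $$ (i, j)) holomorphic_on - \<Lambda>"
proof -
  have c: "F z \<in> carrier_mat n n" for z using F by (auto simp: regular_off_def)
  have h: "(\<lambda>z. F z $$ (i, j)) holomorphic_on - \<Lambda>" if "i < n" "j < n" for i j
    using F that unfolding regular_off_def by (blast intro: holomorphic_on_subset)
  have nz: "Determinant.det (F z) \<noteq> 0" if "z \<notin> \<Lambda>" for z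
    using F that by (auto simp: regular_off_def)
  define R where "R z = inverse (Determinant.det (F z)) \<cdot>\<^sub>m adj_mat (F z)" for z
  have "(\<lambda>z. R z $$ (i, j)) holomorphic_on - \<Lambda>" if ij: "i < n" "j < n" for i j
  proof -
    have "(\<lambda>z. Determinant.det (mat_delete (F z) j i)) holomorphic_on - \<Lambda>"
    proof (rule holomorphic_on_det[of _ "n - 1"])
      show "mat_delete (F z) j i \<in> carrier_mat (n - 1) (n - 1)" for z
        using c[of z] by (auto simp: mat_delete_def)
      fix a b assume ab: "a < n - 1" "b < n - 1"
      \<comment> \<open>Deleting row \<open>j\<close> and column \<open>i\<close> shifts the indices
        from there on by one.\<close>
      have "mat_delete (F z) j i $$ (a, b) =
          F z $$ (if a < j then a else Suc a, if b < i then b else Suc b)" for z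
        using c[of z] ab by (auto simp: mat_delete_def)
      then show "(\<lambda>z. mat_delete (F z) j i $$ (a, b)) holomorphic_on - \<Lambda>"
        using ab by (auto intro!: h)
    qed
    moreover have "R z $$ (i, j) = inverse (Determinant.det (F z)) *
        ((- 1) ^ (j + i) * Determinant.det (mat_delete (F z) j i))" for z
      using ij c[of z] by (auto simp: R_def adj_mat_def cofactor_def)
    ultimately show ?thesis
      using nz by (auto intro!: holomorphic_intros holomorphic_on_det[of _ n] c h)
  qed
  then show thesis
    using that[of R] det_nonzero_inverse[OF c nz] adj_mat(1)[OF c] unfolding R_def by auto
qed

section \<open>Contour integrals and the projected blocks\<close>

text \<open>Each entry of the product is a finite linear combination of entries of
  \<open>R z\<close> with constant coefficients from \<open>G\<close> and \<open>H\<close>. The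
  scalar function \<open>c\<close> carries the weight z^k of a moment.\<close>

lemma contour_integral_sandwich:
  assumes G: "G \<in> carrier_mat n a" and H: "H \<in> carrier_mat b m" and R: "\<And>z. R z \<in> carrier_mat a b"
    and int: "\<And>p q. p < a \<Longrightarrow> q < b \<Longrightarrow> (\<lambda>z. c z * R z $$ (p, q)) contour_integrable_on \<gamma>"
    and ij: "i < n" "j < m"
  shows "contour_integral \<gamma> (\<lambda>z. c z * (G * R z * H) $$ (i, j)) =
    (G * Matrix.mat a b (\<lambda>(p, q). contour_integral \<gamma> (\<lambda>z. c z * R z $$ (p, q))) * H) $$ (i, j)"
proof -
  have expand: "(G * X * H) $$ (i, j) = (\<Sum>q = 0..<b. \<Sum>p = 0..<a. G $$ (i, p) * H $$ (q, j) * X $$ (p, q))"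
    if "X \<in> carrier_mat a b" for X
    using G H that ij by (simp add: scalar_prod_def sum_distrib_left mult_ac) (rule sum.swap)
  have "contour_integral \<gamma> (\<lambda>z. c z * (G * R z * H) $$ (i, j)) = contour_integral \<gamma>
      (\<lambda>z. \<Sum>q = 0..<b. \<Sum>p = 0..<a. G $$ (i, p) * H $$ (q, j) * (c z * R z $$ (p, q)))"
    by (simp only: expand[OF R] sum_distrib_left mult_ac)
  also have "\<dots> = (\<Sum>q = 0..<b. \<Sum>p = 0..<a. G $$ (i, p) * H $$ (q, j) *
      contour_integral \<gamma> (\<lambda>z. c z * R z $$ (p, q)))"
    by (intro contour_integral_unique has_contour_integral_sum has_contour_integral_lmul
        has_contour_integral_integral int) auto
  also have "\<dots> = (G * Matrix.mat a b (\<lambda>(p, q). contour_integral \<gamma> (\<lambda>z. c z * R z $$ (p, q))) * H) $$ (i, j)"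
    by (subst expand) auto
  finally show ?thesis .
qed

text \<open>With zeros around \<open>w\<close>, a combination of a block of columns becomes a
  product with the whole matrix, to which an inverse of that matrix can be applied.\<close>

definition pad_vec :: "nat \<Rightarrow> nat \<Rightarrow> complex Matrix.vec \<Rightarrow> complex Matrix.vec"
  where "pad_vec N k w = Matrix.vec N (\<lambda>i. if k \<le> i \<and> i < k + dim_vec w then w $ (i - k) else 0)"

lemma pad_vec_carrier [simp]: "pad_vec N k w \<in> carrier_vec N"
  by (simp add: pad_vec_def)

lemma pad_vec_index:
  "i < N \<Longrightarrow> pad_vec N k w $ i = (if k \<le> i \<and> i < k + dim_vec w then w $ (i - k) else 0)"
  by (simp add: pad_vec_def)

lemma col_block_carrier [simp]: "Q \<in> carrier_mat n n' \<Longrightarrow> col_block Q k w \<in> carrier_mat n w"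
  by (auto simp: col_block_def)

lemma col_col_block:
  assumes "k + w \<le> dim_col Q" "j < w"
  shows "col (col_block Q k w) j = col Q (k + j)"
  using assms by (intro eq_vecI) (auto simp: col_block_def)

lemma col_block_mult_vec:
  assumes B: "B \<in> carrier_mat m N" and w: "w \<in> carrier_vec d" and kd: "k + d \<le> N"
  shows "col_block B k d *\<^sub>v w = B *\<^sub>v pad_vec N k w"
proof (rule eq_vecI)
  fix i assume "i < dim_vec (B *\<^sub>v pad_vec N k w)"
  then have i: "i < m" using B by simp
  have "(B *\<^sub>v pad_vec N k w) $ i = (\<Sum>l = 0..<N. B $$ (i, l) * pad_vec N k w $ l)"
    using i B by (simp add: scalar_prod_def pad_vec_def)
  also have "\<dots> = (\<Sum>l = k..<k + d. B $$ (i, l) * pad_vec N k w $ l)"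
    using kd w by (intro sum.mono_neutral_right) (auto simp: pad_vec_index)
  also have "\<dots> = (\<Sum>l = 0..<d. B $$ (i, k + l) * w $ l)"
    using kd w
    by (intro sum.reindex_bij_witness[of _ "\<lambda>l. k + l" "\<lambda>l. l - k"]) (auto simp: pad_vec_index)
  also have "\<dots> = (col_block B k d *\<^sub>v w) $ i"
    using i B w by (simp add: scalar_prod_def col_block_def)
  finally show "(col_block B k d *\<^sub>v w) $ i = (B *\<^sub>v pad_vec N k w) $ i" by simp
qed (use B in \<open>auto simp: col_block_def\<close>)

lemma mult_vec_in_range_col_block:
  assumes G: "G \<in> carrier_mat n N" and y: "y \<in> carrier_vec N" and t: "t \<le> N"
    and zero: "\<And>i. t \<le> i \<Longrightarrow> i < N \<Longrightarrow> y $ i = 0"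
  shows "G *\<^sub>v y \<in> range_mat (col_block G 0 t)"
proof -
  let ?w = "Matrix.vec t (\<lambda>i. y $ i)"
  have "pad_vec N 0 ?w = y"
    using y t zero by (intro eq_vecI) (auto simp: pad_vec_def)
  then have "G *\<^sub>v y = col_block G 0 t *\<^sub>v ?w"
    using col_block_mult_vec[OF G, of ?w t 0] t by simp
  moreover have "?w \<in> carrier_vec t" by simp
  ultimately show ?thesis
    unfolding range_mat_eq[OF col_block_carrier[OF G]] by blast
qed

lemma Q_sing_carrier [simp]: "Q \<in> carrier_mat n n' \<Longrightarrow> Q_sing Q q \<in> carrier_mat n q"
  by (simp add: Q_sing_def)

lemma mult_Q_sing_index:
  assumes "T \<in> carrier_mat m n" "Q \<in> carrier_mat n (k + q)" "i < m" "j < q"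
  shows "(T * Q_sing Q q) $$ (i, j) = (T * Q) $$ (i, k + j)"
proof -
  have "col (Q_sing Q q) j = col Q (k + j)"
    using assms by (simp add: Q_sing_def col_col_block)
  then show ?thesis using assms by (simp add: Q_sing_def col_block_def)
qed

text \<open>The last columns of an invertible matrix are independent, as the construction of the
  projector demands. The matrix is kept general because \<open>mat_adjoint P\<close> will also take
  the place of \<open>Q\<close>.\<close>

lemma orth_projector_Q_sing:
  assumes Q: "Q \<in> carrier_mat n n" and Q': "Q' \<in> carrier_mat n n" "Q' * Q = 1\<^sub>m n" and n: "n = k + q"
  obtains E Y where "E \<in> carrier_mat n n" "E * E = E" "mat_adjoint E = E"
    "orth_projector n (orth_compl n (range_mat (Q_sing Q q))) = E"
    "range_mat E = orth_compl n (range_mat (Q_sing Q q))"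
    "Y \<in> carrier_mat q n" "E = 1\<^sub>m n - Q_sing Q q * Y" "E * Q_sing Q q = 0\<^sub>m n q"
proof -
  have C: "Q_sing Q q \<in> carrier_mat n q" using Q by simp
  have inj: "u = 0\<^sub>v q" if u: "u \<in> carrier_vec q" "Q_sing Q q *\<^sub>v u = 0\<^sub>v n" for u
  proof -
    have "Q *\<^sub>v pad_vec n k u = 0\<^sub>v n"
      using u col_block_mult_vec[OF Q u(1), of k] Q n by (simp add: Q_sing_def)
    then have "Q' *\<^sub>v (Q *\<^sub>v pad_vec n k u) = 0\<^sub>v n" using Q' by auto
    then have 0: "pad_vec n k u = 0\<^sub>v n"
      using Q Q' by (simp add: assoc_mult_mat_vec[of _ n n _ n, symmetric])
    show ?thesis
    proof (rule eq_vecI)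
      fix i assume "i < dim_vec (0\<^sub>v q :: complex Matrix.vec)"
      then show "u $ i = 0\<^sub>v q $ i"
        using arg_cong[OF 0, of "\<lambda>v. v $ (k + i)"] u n by (simp add: pad_vec_index)
    qed (use u in auto)
  qed
  obtain E Y where "E \<in> carrier_mat n n" "E * E = E" "mat_adjoint E = E"
    "range_mat E = orth_compl n (range_mat (Q_sing Q q))" "Y \<in> carrier_mat q n"
    "E = 1\<^sub>m n - Q_sing Q q * Y" "E * Q_sing Q q = 0\<^sub>m n q"
    using orth_projector_exists[OF C inj] by blast
  then show thesis using that orth_projector_eq by blast
qed

text \<open>The projector differs from the identity by a product with left factor
  \<open>Q_sing Q q\<close>, and \<open>T\<close> annihilates that factor.\<close>

lemma mult_projector_Q_sing:
  assumes T: "T \<in> carrier_mat m n" and Q: "Q \<in> carrier_mat n n" and n: "n = k + q"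
    and zero: "\<And>i j. i < m \<Longrightarrow> k \<le> j \<Longrightarrow> j < n \<Longrightarrow> (T * Q) $$ (i, j) = 0"
    and Y: "Y \<in> carrier_mat q n"
  shows "T * (1\<^sub>m n - Q_sing Q q * Y) = T"
proof -
  have C: "Q_sing Q q \<in> carrier_mat n q" using Q by simp
  have "T * Q_sing Q q = 0\<^sub>m m q"
  proof (rule eq_matI)
    fix i j assume "i < dim_row (0\<^sub>m m q :: complex mat)" "j < dim_col (0\<^sub>m m q :: complex mat)"
    then show "(T * Q_sing Q q) $$ (i, j) = 0\<^sub>m m q $$ (i, j)"
      using mult_Q_sing_index[of T m n Q k q i j] T Q n zero by simp
  qed (use T C in auto)
  then have "T * (Q_sing Q q * Y) = 0\<^sub>m m n"
    using T C Y by (subst assoc_mult_mat[of _ m n _ q _ n, symmetric]) auto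
  then show ?thesis using T C Y by (subst mult_minus_distrib_mat[of _ m n _ n]) auto
qed

lemma projector_mult_tail_zero:
  assumes E: "E \<in> carrier_mat n n" and Q: "Q \<in> carrier_mat n n" and n: "n = k + q"
    and EC: "E * Q_sing Q q = 0\<^sub>m n q" and ij: "i < n" "k \<le> j" "j < n"
  shows "(E * Q) $$ (i, j) = 0"
proof -
  have "(E * Q) $$ (i, j) = (E * Q_sing Q q) $$ (i, j - k)"
    using mult_Q_sing_index[of E n n Q k q i "j - k"] assms by simp
  then show ?thesis using EC ij n by simp
qed

text \<open>The products \<open>X * T\<close> and \<open>T * X\<close> turn out to be the projectors
  \<open>E\<close> and \<open>F\<close>, from which all four Penrose equations follow. By
  \<open>RK\<close> and \<open>KR\<close>, \<open>R\<close> has to invert the canonical form only up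
  to what \<open>E * Q\<close> and \<open>P * F\<close> annihilate.\<close>

lemma pinv_sandwich:
  assumes T: "T \<in> carrier_mat m n"
    and P: "P \<in> carrier_mat m m" "P' \<in> carrier_mat m m" "P' * P = 1\<^sub>m m"
    and Q: "Q \<in> carrier_mat n n" "Q' \<in> carrier_mat n n" "Q * Q' = 1\<^sub>m n"
    and R: "R \<in> carrier_mat n m"
    and E: "E \<in> carrier_mat n n" "E * E = E" "mat_adjoint E = E" "T * E = T"
    and F: "F \<in> carrier_mat m m" "F * F = F" "mat_adjoint F = F" "F * T = T"
    and RK: "E * Q * (R * (P * T * Q)) = E * Q" and KR: "P * T * Q * R * (P * F) = P * F"
  shows "pinv T = E * Q * R * (P * F)"
proof -
  define X where "X = E * Q * R * (P * F)"
  have EQ: "E * Q \<in> carrier_mat n n" and PF: "P * F \<in> carrier_mat m m" using E F P Q by auto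
  have EQR: "E * Q * R \<in> carrier_mat n m" using EQ R by auto
  have X: "X \<in> carrier_mat n m" using EQR PF by (auto simp: X_def)
  have PT: "P * T \<in> carrier_mat m n" using P T by auto
  have XT: "X * T = E"
  proof -
    have "X * T = E * Q * R * (P * F * T)"
      unfolding X_def using EQR PF T by (rule assoc_mult_mat)
    also have "P * F * T = P * T" using P F T by (subst assoc_mult_mat[of _ m m _ m _ n]) auto
    \<comment> \<open>Inserting \<open>Q * Q'\<close> produces the canonical form
      \<open>P * T * Q\<close>, to which \<open>RK\<close> applies; further down, inserting
      \<open>P' * P\<close> does the same for \<open>KR\<close>.\<close>
    also have "P * T = P * T * Q * Q'"
      using PT Q by (subst assoc_mult_mat[of _ m n _ n _ n]) auto
    also have "E * Q * R * \<dots> = E * Q * (R * (P * T * Q)) * Q'"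
      using EQ R PT Q
      by (simp add: assoc_mult_mat[of "E * Q" n n R m _ n]
          assoc_mult_mat[of "E * Q" n n "R * (P * T * Q)" n Q' n]
          assoc_mult_mat[of R n m "P * T * Q" n Q' n])
    also have "\<dots> = E" unfolding RK using E Q by (subst assoc_mult_mat[of _ n n _ n _ n]) auto
    finally show ?thesis .
  qed
  have TX: "T * X = F"
  proof -
    have "T * X = T * (E * Q * R) * (P * F)"
      unfolding X_def using T EQR PF by (intro assoc_mult_mat[symmetric]) auto
    also have "T * (E * Q * R) = T * (E * Q) * R"
      using T EQ R by (intro assoc_mult_mat[symmetric]) auto
    also have "T * (E * Q) = T * Q"
      using T E Q by (subst assoc_mult_mat[of _ m n _ n _ n, symmetric]) auto
    also have "\<dots> = P' * (P * T * Q)"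
      using P T Q
      by (simp add: assoc_mult_mat[of P m m T n Q n])
        (subst assoc_mult_mat[of P' m m P m "T * Q" n, symmetric]; simp)
    also have "P' * (P * T * Q) * R = P' * (P * T * Q * R)"
      using P PT Q R by (intro assoc_mult_mat) auto
    also have "\<dots> * (P * F) = P' * (P * T * Q * R * (P * F))"
      using P PT Q R PF by (intro assoc_mult_mat) auto
    also have "\<dots> = F"
      unfolding KR using P F by (subst assoc_mult_mat[of _ m m _ m _ m, symmetric]) auto
    finally show ?thesis .
  qed
  have "X * T * X = E * (E * Q * R) * (P * F)"
    unfolding XT unfolding X_def using E EQR PF by (intro assoc_mult_mat[symmetric]) auto
  also have "E * (E * Q * R) = E * (E * Q) * R"
    using E EQ R by (intro assoc_mult_mat[symmetric]) auto
  also have "E * (E * Q) = E * Q"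
    using E Q by (subst assoc_mult_mat[of _ n n _ n _ n, symmetric]) auto
  finally have XTX: "X * T * X = X" by (simp only: X_def)
  show ?thesis
    unfolding X_def[symmetric] using T X
    by (rule pinv_eq) (simp_all only: TX XT F E XTX XTX[unfolded XT])
qed

text \<open>The finite blocks occupy adjacent columns from column 0 on, so projecting them one by
  one and concatenating yields the leading columns of \<open>E * Q\<close>.\<close>

lemma Q_hat_Omega_eq:
  assumes Q: "Q \<in> carrier_mat n n" and E: "E \<in> carrier_mat n n"
    and proj: "orth_projector n (orth_compl n (range_mat (Q_sing Q q))) = E"
    and "s \<le> length fb" "sum_list (map fst (take s fb)) \<le> n"
  shows "Q_hat_Omega Q fb q s = col_block (E * Q) 0 (sum_list (map fst (take s fb)))"
proof -
  have d: "dim_row Q = n" using Q by simp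
  have "concat (map cols (map (Q_hat Q fb q) [0..<s]))
      = map (col (E * Q)) [0..<sum_list (map fst (take s fb))]"
    using assms(4,5)
  proof (induction s)
    case 0
    then show ?case by simp
  next
    case (Suc s)
    let ?k = "sum_list (map fst (take s fb))" and ?e = "fst (fb ! s)"
    have k: "sum_list (map fst (take (Suc s) fb)) = ?k + ?e"
      using Suc.prems by (simp add: take_Suc_conv_app_nth)
    have ke: "?k + ?e \<le> n" using Suc.prems k by simp
    have C: "Q_fin Q fb s \<in> carrier_mat n ?e" using Q by (simp add: Q_fin_def)
    have "cols (Q_hat Q fb q s) = map (col (E * Q)) [?k..<?k + ?e]"
    proof (rule nth_equalityI)
      show "length (cols (Q_hat Q fb q s)) = length (map (col (E * Q)) [?k..<?k + ?e])"
        using C by (simp add: Q_hat_def)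
      fix j assume "j < length (cols (Q_hat Q fb q s))"
      then have j: "j < ?e" using C by (simp add: Q_hat_def)
      have "cols (Q_hat Q fb q s) ! j = col (E * Q_fin Q fb s) j"
        using C j proj by (simp add: Q_hat_def d)
      also have "\<dots> = E *\<^sub>v col (Q_fin Q fb s) j" using E C j by (rule col_mult2)
      also have "col (Q_fin Q fb s) j = col Q (?k + j)"
        unfolding Q_fin_def using Q ke j by (intro col_col_block) auto
      also have "E *\<^sub>v \<dots> = col (E * Q) (?k + j)"
        using E Q ke j by (intro col_mult2[symmetric]) auto
      finally show "cols (Q_hat Q fb q s) ! j = map (col (E * Q)) [?k..<?k + ?e] ! j"
        using j by simp
    qed
    moreover have "concat (map cols (map (Q_hat Q fb q) [0..<s])) = map (col (E * Q)) [0..<?k]"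
      using Suc.prems(1) ke by (intro Suc.IH) linarith+
    moreover have "[0..<?k + ?e] = [0..<?k] @ [?k..<?k + ?e]"
      by (rule upt_add_eq_append) simp
    ultimately show ?case unfolding k by (simp only: upt_Suc) simp
  qed
  then show ?thesis
    unfolding Q_hat_Omega_def hcat_def d using assms
    by (intro eq_matI) (auto simp: col_block_def mat_of_cols_index)
qed

lemma invertible_mat_inverse:
  assumes "invertible_mat P" "(P :: complex mat) \<in> carrier_mat m m"
  obtains P' where "P' \<in> carrier_mat m m" "P * P' = 1\<^sub>m m" "P' * P = 1\<^sub>m m"
proof -
  \<comment> \<open>\<open>invertible_mat\<close> does not state the shape of the inverse; it is
    read off from the two identities.\<close>
  obtain P' where P': "P * P' = 1\<^sub>m m" "P' * P = 1\<^sub>m (dim_row P')"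
    using assms by (auto simp: invertible_mat_def inverts_mat_def)
  have "dim_col P' = m" using arg_cong[OF P'(1), of dim_col] by simp
  moreover have "dim_row P' = m" using arg_cong[OF P'(2), of dim_col] assms by simp
  ultimately show thesis using that P' by auto
qed

section \<open>Moment matrices of a Kronecker pencil\<close>

text \<open>Regrouping into three blocks: the first \<open>s\<close> finite blocks, the rest of the
  regular part, and the singular zero block. The cut at \<open>s\<close> will separate what survives
  the contour integration in the leading rows from what does not.\<close>

lemma kronecker_form_block_diag:
  "kronecker_form fb ib r q z = block_diag
    (block_diag (diag_block_mat (map (\<lambda>(e, \<mu>). z \<cdot>\<^sub>m 1\<^sub>m e - jordan_block e \<mu>) (take s fb)))
      (diag_block_mat (map (\<lambda>(e, \<mu>). z \<cdot>\<^sub>m 1\<^sub>m e - jordan_block e \<mu>) (drop s fb)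
        @ map (\<lambda>k. z \<cdot>\<^sub>m jordan_block k 0 - 1\<^sub>m k) ib)))
    (0\<^sub>m r q)"
proof -
  have "map f fb = map f (take s fb) @ map f (drop s fb)" for f :: "_ \<Rightarrow> complex mat"
    by (simp flip: map_append)
  then show ?thesis
    unfolding kronecker_form_def
    by (simp only: append_assoc[symmetric] diag_block_mat_append_block_diag[of _ "[0\<^sub>m r q]"]
        diag_block_mat_singleton)
      (simp only: append_assoc diag_block_mat_append_block_diag[of "map _ (take s fb)"])
qed

text \<open>It serves both regular groups: the eigenvalues in \<Omega> with \<open>ib\<close> empty,
  and the other ones together with the nilpotent blocks.\<close>

lemma regular_off_finite_blocks:
  assumes "snd ` set fb \<subseteq> \<Lambda>"
  shows "regular_off \<Lambda> (sum_list (map fst fb) + sum_list ib)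
    (\<lambda>z. diag_block_mat (map (\<lambda>(e, \<mu>). z \<cdot>\<^sub>m 1\<^sub>m e - jordan_block e \<mu>) fb
      @ map (\<lambda>k. z \<cdot>\<^sub>m jordan_block k 0 - 1\<^sub>m k) ib))"
proof -
  let ?L = "map (\<lambda>(e, \<mu>). (e, \<lambda>z. z \<cdot>\<^sub>m 1\<^sub>m e - jordan_block e \<mu>)) fb
    @ map (\<lambda>k. (k, \<lambda>z. z \<cdot>\<^sub>m jordan_block k 0 - 1\<^sub>m k)) ib"
  have "regular_off \<Lambda> e F" if "(e, F) \<in> set ?L" for e F
    using that assms by (force intro: regular_off_jordan regular_off_nilpotent)
  from regular_off_diag_block_mat[of ?L, OF this]
  show ?thesis
    by (simp add: o_def case_prod_unfold)
qed

lemma smult_mat_mult_vec: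
  assumes "(A :: complex mat) \<in> carrier_mat m n" "v \<in> carrier_vec n"
  shows "(c \<cdot>\<^sub>m A) *\<^sub>v v = c \<cdot>\<^sub>v (A *\<^sub>v v)"
  using assms by (intro eq_vecI) (auto simp: scalar_prod_def sum_distrib_left mult.assoc)

theorem theorem2p6:
  fixes A B P Q V S X :: "complex mat"
    and fb :: "(nat \<times> complex) list" and ib :: "nat list"
    and m n r q s t L M :: nat
    and \<gamma> :: "real \<Rightarrow> complex" and \<Omega> :: "complex set"
  assumes "kronecker_decomposition m n A B P Q fb ib r q"
    and "pos_jordan_curve \<gamma>"
    and "\<Omega> = inside (path_image \<gamma>)"
    and "\<forall>i<length fb. snd (fb ! i) \<notin> path_image \<gamma>"
    and "s \<le> length fb"
    and "\<forall>i<s. snd (fb ! i) \<in> \<Omega>"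
    and "\<forall>i. s \<le> i \<and> i < length fb \<longrightarrow> snd (fb ! i) \<notin> \<Omega>"
    and "t = (\<Sum>i<s. fst (fb ! i))"
    and "0 < L" and "0 < M" and "L < min m n" and "M < n"
    and "V \<in> carrier_mat m L"
    and "S = hcat n (map (\<lambda>k. moment \<gamma> A B k * V) [0..<M])"
    and "eigenvectors_in_Omega A B Q fb q s X"
  shows "vec_space.rank n S = t \<longleftrightarrow>
    range_mat (Q_hat_Omega Q fb q s) = range_mat S \<and> range_mat S \<supseteq> range_mat X"
proof -

  \<comment> \<open>Dimensions and inverse transformations\<close>
  define T where "T = pencil A B"
  \<comment> \<open>\<open>t'\<close> is the order of the second regular group and \<open>N\<close>
    that of the whole regular part; the singular block starts at row and column
    \<open>N\<close>.\<close>
  define t' where "t' = sum_list (map fst (drop s fb)) + sum_list ib"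
  define N where "N = t + t'"
  have A: "A \<in> carrier_mat m n" and B: "B \<in> carrier_mat m n"
    and P: "P \<in> carrier_mat m m" "invertible_mat P" and Q: "Q \<in> carrier_mat n n" "invertible_mat Q"
    and PTQ: "P * T z * Q = kronecker_form fb ib r q z" for z
    using assms(1) by (auto simp: kronecker_decomposition_def T_def)
  have t: "sum_list (map fst (take s fb)) = t"
    using assms(5,8) by (simp add: sum_list_sum_nth atLeast0LessThan min_absorb2)
  have "sum_list (map fst fb) = t + sum_list (map fst (drop s fb))"
    by (metis append_take_drop_id map_append sum_list_append t)
  then have m: "m = N + r" and n: "n = N + q"
    using assms(1) by (auto simp: kronecker_decomposition_def N_def t'_def)
  have tN: "t \<le> N" by (simp add: N_def)
  have T: "T z \<in> carrier_mat m n" for z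
    unfolding T_def pencil_def using A B by (intro minus_carrier_mat) auto
  obtain P' where P': "P' \<in> carrier_mat m m" "P * P' = 1\<^sub>m m" "P' * P = 1\<^sub>m m"
    using invertible_mat_inverse P by blast
  obtain Q' where Q': "Q' \<in> carrier_mat n n" "Q * Q' = 1\<^sub>m n" "Q' * Q = 1\<^sub>m n"
    using invertible_mat_inverse Q by blast

  \<comment> \<open>Regular blocks of the Kronecker form and their inverses\<close>
  define K1 where "K1 = (\<lambda>z. diag_block_mat
    (map (\<lambda>(e, \<mu>). z \<cdot>\<^sub>m 1\<^sub>m e - jordan_block e \<mu>) (take s fb)))"
  define K2 where "K2 = (\<lambda>z. diag_block_mat
    (map (\<lambda>(e, \<mu>). z \<cdot>\<^sub>m 1\<^sub>m e - jordan_block e \<mu>) (drop s fb)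
      @ map (\<lambda>k. z \<cdot>\<^sub>m jordan_block k 0 - 1\<^sub>m k) ib))"
  define \<Lambda>1 where "\<Lambda>1 = snd ` set (take s fb)"
  define \<Lambda>2 where "\<Lambda>2 = snd ` set (drop s fb)"
  have K: "P * T z * Q = block_diag (block_diag (K1 z) (K2 z)) (0\<^sub>m r q)" for z
    unfolding PTQ K1_def K2_def by (rule kronecker_form_block_diag)
  have reg1: "regular_off \<Lambda>1 t K1" and reg2: "regular_off \<Lambda>2 t' K2"
    using regular_off_finite_blocks[of "take s fb" \<Lambda>1 "[]"]
      regular_off_finite_blocks[of "drop s fb" \<Lambda>2 ib]
    by (simp_all add: \<Lambda>1_def \<Lambda>2_def K1_def K2_def t t'_def)
  obtain R1 where R1: "\<And>z. R1 z \<in> carrier_mat t t"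
    "\<And>z. z \<notin> \<Lambda>1 \<Longrightarrow> K1 z * R1 z = 1\<^sub>m t" "\<And>z. z \<notin> \<Lambda>1 \<Longrightarrow> R1 z * K1 z = 1\<^sub>m t"
    "\<And>i j. i < t \<Longrightarrow> j < t \<Longrightarrow> (\<lambda>z. R1 z $$ (i, j)) holomorphic_on - \<Lambda>1"
    using regular_off_inverse[OF reg1] by blast
  obtain R2 where R2: "\<And>z. R2 z \<in> carrier_mat t' t'"
    "\<And>z. z \<notin> \<Lambda>2 \<Longrightarrow> K2 z * R2 z = 1\<^sub>m t'" "\<And>z. z \<notin> \<Lambda>2 \<Longrightarrow> R2 z * K2 z = 1\<^sub>m t'"
    "\<And>i j. i < t' \<Longrightarrow> j < t' \<Longrightarrow> (\<lambda>z. R2 z $$ (i, j)) holomorphic_on - \<Lambda>2"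
    using regular_off_inverse[OF reg2] by blast
  have K1: "K1 z \<in> carrier_mat t t" and K2: "K2 z \<in> carrier_mat t' t'" for z
    using reg1 reg2 by (auto simp: regular_off_def)
  \<comment> \<open>Off the finite eigenvalues this is a generalized inverse of the Kronecker form.
    The zero block has the transposed shape, \<open>q\<close> by \<open>r\<close>.\<close>
  define R where "R z = block_diag (block_diag (R1 z) (R2 z)) (0\<^sub>m q r)" for z
  have R: "R z \<in> carrier_mat n m" for z
    unfolding R_def m n N_def using R1 R2 by simp
  have one: "block_diag (1\<^sub>m t) (1\<^sub>m t') = 1\<^sub>m N"
    by (simp add: block_diag_def N_def)
  have KR: "P * T z * Q * R z = block_diag (1\<^sub>m N) (0\<^sub>m r r)"
    and RK: "R z * (P * T z * Q) = block_diag (1\<^sub>m N) (0\<^sub>m q q)" if "z \<notin> \<Lambda>1 \<union> \<Lambda>2" for z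
  proof -
    have *: "block_diag (K1 z) (K2 z) * block_diag (R1 z) (R2 z) = 1\<^sub>m N"
      "block_diag (R1 z) (R2 z) * block_diag (K1 z) (K2 z) = 1\<^sub>m N"
      using that R1 R2 one
      by (simp_all add: block_diag_mult[OF K1 K2 R1(1) R2(1)] block_diag_mult[OF R1(1) R2(1) K1 K2])
    have c: "block_diag (K1 z) (K2 z) \<in> carrier_mat N N" "block_diag (R1 z) (R2 z) \<in> carrier_mat N N"
      using K1 K2 R1 R2 by (simp_all add: N_def)
    show "P * T z * Q * R z = block_diag (1\<^sub>m N) (0\<^sub>m r r)"
      unfolding K R_def by (subst block_diag_mult[OF c(1) _ c(2)]) (auto simp: *)
    show "R z * (P * T z * Q) = block_diag (1\<^sub>m N) (0\<^sub>m q q)"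
      unfolding K R_def by (subst block_diag_mult[OF c(2) _ c(1)]) (auto simp: *)
  qed

  \<comment> \<open>Orthogonal projectors and the pseudoinverse of the pencil\<close>
  obtain E Y where E: "E \<in> carrier_mat n n" "E * E = E" "mat_adjoint E = E"
    and projE: "orth_projector n (orth_compl n (range_mat (Q_sing Q q))) = E"
    and rangeE: "range_mat E = orth_compl n (range_mat (Q_sing Q q))"
    and Y: "Y \<in> carrier_mat q n" "E = 1\<^sub>m n - Q_sing Q q * Y" and EC: "E * Q_sing Q q = 0\<^sub>m n q"
    using orth_projector_Q_sing[OF Q(1) Q'(1,3) n] by blast
  let ?P = "mat_adjoint P" and ?P' = "mat_adjoint P'"
  have PH: "?P \<in> carrier_mat m m" "?P' \<in> carrier_mat m m" "?P' * ?P = 1\<^sub>m m"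
    using P P' mat_adjoint_mult[OF P(1) P'(1)] by auto
  \<comment> \<open>The last \<open>r\<close> columns of \<open>mat_adjoint P\<close> form P_s^H, so
    \<open>F\<close> is the orthogonal projector onto R(P_s^H)^perp.\<close>
  obtain F Z where F: "F \<in> carrier_mat m m" "F * F = F" "mat_adjoint F = F"
    and Z: "Z \<in> carrier_mat r m" "F = 1\<^sub>m m - Q_sing ?P r * Z" and FC: "F * Q_sing ?P r = 0\<^sub>m m r"
    using orth_projector_Q_sing[OF PH m] by blast

  define G where "G = E * Q"
  define H where "H = P * F"
  have G: "G \<in> carrier_mat n n" and H: "H \<in> carrier_mat m m" using E F P Q by (auto simp: G_def H_def)
  \<comment> \<open>\<open>T z * Q\<close> is \<open>P'\<close> times the Kronecker form, whose last
    \<open>q\<close> columns vanish for every \<open>z\<close>.\<close>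
  have TE: "T z * E = T z" for z
    unfolding Y(2)
  proof (rule mult_projector_Q_sing[OF T Q(1) n _ Y(1)])
    fix i j assume ij: "i < m" "N \<le> j" "j < n"
    have TQ: "T z * Q \<in> carrier_mat m n" using T Q(1) by (rule mult_carrier_mat)
    have "T z * Q = P' * (P * (T z * Q))"
      using P P' TQ by (subst assoc_mult_mat[of _ m m _ m _ n, symmetric]) auto
    also have "P * (T z * Q) = P * T z * Q" using P T Q by (intro assoc_mult_mat[symmetric]) auto
    finally have "(T z * Q) $$ (i, j) = row P' i \<bullet> col (P * T z * Q) j"
      using ij P' P T Q by simp
    also have "col (P * T z * Q) j = 0\<^sub>v m"
      unfolding K using ij K1[of z] K2[of z] m n
      by (intro eq_vecI) (auto simp: block_diag_index N_def)
    finally show "(T z * Q) $$ (i, j) = 0" using P' ij by simp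
  qed
  \<comment> \<open>The column-side lemmas, applied to the adjoint pencil, with \<open>P\<close> adjoint in the role of \<open>Q\<close>.\<close>
  have FT: "F * T z = T z" for z
  proof -
    have TH: "mat_adjoint (T z) \<in> carrier_mat n m" using T by simp
    have "mat_adjoint (T z) * F = mat_adjoint (T z)"
      unfolding Z(2)
    proof (rule mult_projector_Q_sing[OF TH PH(1) m _ Z(1)])
      fix i j assume ij: "i < n" "N \<le> j" "j < m"
      have PT: "P * T z \<in> carrier_mat m n" using P(1) T by (rule mult_carrier_mat)
      have "P * T z = P * T z * Q * Q'" using PT Q Q' by (subst assoc_mult_mat) auto
      then have "(P * T z) $$ (j, i) = row (P * T z * Q) j \<bullet> col Q' i"
        using ij P T Q Q' by (metis PT carrier_matD index_mult_mat)
      also have "row (P * T z * Q) j = 0\<^sub>v n"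
        unfolding K using ij K1[of z] K2[of z] m n
        by (intro eq_vecI) (auto simp: block_diag_index N_def)
      finally have "(P * T z) $$ (j, i) = 0" using Q' ij by simp
      then show "(mat_adjoint (T z) * ?P) $$ (i, j) = 0"
        using mat_adjoint_mult[OF P(1) T] PT ij by (metis carrier_matD conjugate_zero mat_adjoint_index)
    qed
    then have "mat_adjoint (mat_adjoint (T z) * F) = T z" by simp
    then show ?thesis using mat_adjoint_mult[OF TH F(1)] F(3) by simp
  qed
  \<comment> \<open>\<open>E\<close> annihilates the last \<open>q\<close> columns of
    \<open>Q\<close>, so erasing the singular coordinates does not change \<open>G\<close>;
    \<open>DH\<close> is the counterpart for the rows of \<open>H\<close>, obtained through
    adjoints.\<close>
  have GD: "G * block_diag (1\<^sub>m N) (0\<^sub>m q q) = G"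
    using G projector_mult_tail_zero[OF E(1) Q(1) n EC] n
    by (intro mult_block_diag_one_zero) (auto simp: G_def)
  have DH: "block_diag (1\<^sub>m N) (0\<^sub>m r r) * H = H"
  proof -
    have "F * ?P * block_diag (1\<^sub>m N) (0\<^sub>m r r) = F * ?P"
      using F PH projector_mult_tail_zero[OF F(1) PH(1) m FC] m
      by (intro mult_block_diag_one_zero[of _ m]) auto
    moreover have "mat_adjoint H = F * ?P"
      unfolding H_def using mat_adjoint_mult[OF P(1) F(1)] F by simp
    moreover have "mat_adjoint (block_diag (1\<^sub>m N) (0\<^sub>m r r)) = block_diag (1\<^sub>m N) (0\<^sub>m r r)"
      by (intro eq_matI) (auto simp: block_diag_index)
    moreover have D: "block_diag (1\<^sub>m N) (0\<^sub>m r r) \<in> carrier_mat m m" by (simp add: m)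
    ultimately have "mat_adjoint (block_diag (1\<^sub>m N) (0\<^sub>m r r) * H) = mat_adjoint H"
      using mat_adjoint_mult[OF D H] by simp
    then show ?thesis by (metis mat_adjoint_adjoint)
  qed
  have pinvT: "pinv (T z) = G * R z * H" if "z \<notin> \<Lambda>1 \<union> \<Lambda>2" for z
    unfolding G_def H_def
    by (rule pinv_sandwich[OF T P(1) P'(1,3) Q(1) Q'(1,2) R E TE F FT])
      (simp_all only: KR[OF that] RK[OF that] GD[unfolded G_def] DH[unfolded H_def])

  \<comment> \<open>Contour integrals of the generalized inverse\<close>
  have curve: "valid_path \<gamma>" "pathfinish \<gamma> = pathstart \<gamma>"
    using assms(2) by (auto simp: pos_jordan_curve_def)
  have off: "z \<notin> \<Lambda>1 \<union> \<Lambda>2" if "z \<in> path_image \<gamma>" for z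
  proof -
    have "\<Lambda>1 \<union> \<Lambda>2 = snd ` set fb"
      unfolding \<Lambda>1_def \<Lambda>2_def by (metis append_take_drop_id image_Un set_append)
    then show ?thesis using that assms(4) by (metis imageE in_set_conv_nth)
  qed
  \<comment> \<open>An eigenvalue of the second group is neither on the curve nor inside it, which
    leaves only the outside.\<close>
  have out: "z \<in> outside (path_image \<gamma>)" if z2: "z \<in> \<Lambda>2" for z
  proof -
    obtain j where "j < length (drop s fb)" "z = snd (drop s fb ! j)"
      using z2 unfolding \<Lambda>2_def by (metis imageE in_set_conv_nth)
    then obtain i where "s \<le> i" "i < length fb" "z = snd (fb ! i)"
      using that[of "s + j"] assms(5) by auto
    then have "z \<notin> path_image \<gamma>" "z \<notin> inside (path_image \<gamma>)" using assms(3,4,7) by auto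
    then show ?thesis using inside_Un_outside[of "path_image \<gamma>"] by blast
  qed
  have R_index: "R z $$ (i, j) = (if i < t then (if j < t then R1 z $$ (i, j) else 0)
      else if i < N \<and> t \<le> j \<and> j < N then R2 z $$ (i - t, j - t) else 0)"
    if "i < n" "j < m" for z i j
    using that R1(1)[of z] R2(1)[of z] by (auto simp: R_def block_diag_index m n N_def)
  have hol1: "(\<lambda>z. z ^ k * R z $$ (i, j)) holomorphic_on - (\<Lambda>1 \<union> \<Lambda>2)" if "i < n" "j < m" for i j k
  proof -
    have "(\<lambda>z. R1 z $$ (i, j)) holomorphic_on - (\<Lambda>1 \<union> \<Lambda>2)" if "i < t" "j < t"
      using R1(4)[OF that] by (rule holomorphic_on_subset) auto
    moreover have "(\<lambda>z. R2 z $$ (i - t, j - t)) holomorphic_on - (\<Lambda>1 \<union> \<Lambda>2)"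
      if "\<not> i < t" "i < N" "t \<le> j" "j < N"
      by (rule holomorphic_on_subset[OF R2(4)]) (use that in \<open>auto simp: N_def\<close>)
    ultimately show ?thesis
      using that
      by (cases "i < t"; cases "j < t"; cases "i < N \<and> t \<le> j \<and> j < N")
        (auto simp: R_index intro!: holomorphic_intros)
  qed
  \<comment> \<open>Rows from \<open>t\<close> on consist of entries of \<open>R2\<close> and zeros,
    so the eigenvalues in \<Omega> are no singularities there. \<open>hol1\<close> serves the
    integrability of all entries.\<close>
  have hol2: "(\<lambda>z. z ^ k * R z $$ (i, j)) holomorphic_on - \<Lambda>2"
    if "i < n" "j < m" "t \<le> i" for i j k
  proof -
    have "(\<lambda>z. R2 z $$ (i - t, j - t)) holomorphic_on - \<Lambda>2" if "i < N" "t \<le> j" "j < N"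
      using R2(4)[of "i - t" "j - t"] that \<open>t \<le> i\<close> by (auto simp: N_def)
    then show ?thesis
      using that by (cases "i < N \<and> t \<le> j \<and> j < N") (auto simp: R_index intro!: holomorphic_intros)
  qed
  have fin: "finite \<Lambda>1" "finite \<Lambda>2" by (auto simp: \<Lambda>1_def \<Lambda>2_def)
  define W where "W k = Matrix.mat n m
    (\<lambda>(i, j). contour_integral \<gamma> (\<lambda>z. z ^ k * R z $$ (i, j)))" for k
  have W: "W k \<in> carrier_mat n m" for k by (simp add: W_def)
  \<comment> \<open>Cauchy's theorem: all possible singularities of these entries lie outside the
    curve.\<close>
  have W0: "W k $$ (i, j) = 0" if "i < n" "j < m" "t \<le> i" for i j k
  proof -
    have "((\<lambda>z. z ^ k * R z $$ (i, j)) has_contour_integral 0) \<gamma>"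
      using fin off out curve hol2[OF that]
      by (intro Cauchy_theorem_global_outside[of "- \<Lambda>2"]) (auto intro: finite_imp_closed)
    then show ?thesis using that by (simp add: W_def contour_integral_unique)
  qed
  have int: "(\<lambda>z. z ^ k * R z $$ (i, j)) contour_integrable_on \<gamma>" if "i < n" "j < m" for i j k
    using fin off curve hol1[OF that]
    by (intro contour_integrable_holomorphic_simple[of _ "- (\<Lambda>1 \<union> \<Lambda>2)"])
      (auto intro: finite_imp_closed)
  define c where "c = 1 / (2 * complex_of_real pi * \<i>)"
  have moment_eq: "moment \<gamma> A B k = c \<cdot>\<^sub>m (G * W k * H)" for k
  proof (rule eq_matI)
    fix i j assume "i < dim_row (c \<cdot>\<^sub>m (G * W k * H))" "j < dim_col (c \<cdot>\<^sub>m (G * W k * H))"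
    then have ij: "i < n" "j < m" using G H by auto
    have "contour_integral \<gamma> (\<lambda>z. z ^ k * pinv (T z) $$ (i, j))
        = contour_integral \<gamma> (\<lambda>z. z ^ k * (G * R z * H) $$ (i, j))"
      \<comment> \<open>The formula for the pseudoinverse holds off the eigenvalues; the integral
        depends only on values on the curve, which avoids them.\<close>
      using pinvT off by (intro contour_integral_eq) simp
    also have "\<dots> = (G * W k * H) $$ (i, j)"
      unfolding W_def by (rule contour_integral_sandwich[OF G H R int ij])
    finally show "moment \<gamma> A B k $$ (i, j) = (c \<cdot>\<^sub>m (G * W k * H)) $$ (i, j)"
      using ij A G H by (simp add: moment_def c_def T_def)
  qed (use A G H in \<open>auto simp: moment_def\<close>)

  \<comment> \<open>The range of S within the range of the projected blocks\<close>
  define U where "U = Q_hat_Omega Q fb q s"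
  have U_eq: "U = col_block G 0 t"
    using Q_hat_Omega_eq[OF Q(1) E(1) projE assms(5)] tN n by (simp add: U_def G_def t)
  have U: "U \<in> carrier_mat n t" unfolding U_eq using G by simp
  have tn: "t \<le> n" using tN n by simp
  have moment_cols: "x \<in> range_mat U" if "x \<in> set (cols (moment \<gamma> A B k * V))" for x k
  proof -
    have V: "V \<in> carrier_mat m L" by fact
    \<comment> \<open>A local \<open>X\<close>, distinct from the matrix of eigenvectors. Its rows
      from \<open>t\<close> on vanish with those of \<open>W k\<close>, so \<open>G * X\<close>
      involves only the first \<open>t\<close> columns of \<open>G\<close>.\<close>
    define X where "X = c \<cdot>\<^sub>m (W k * (H * V))"
    have HV: "H * V \<in> carrier_mat m L" using H V by auto
    have WHV: "W k * (H * V) \<in> carrier_mat n L" using W HV by (rule mult_carrier_mat)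
    have X: "X \<in> carrier_mat n L" using WHV by (simp add: X_def)
    have "moment \<gamma> A B k * V = c \<cdot>\<^sub>m (G * W k * H * V)"
      unfolding moment_eq using G W H V by (intro mult_smult_assoc_mat[of _ n m _ L]) auto
    also have "G * W k * H * V = G * (W k * (H * V))"
      using G W H V HV
      by (simp add: assoc_mult_mat[of "G * W k" n m H m V L] assoc_mult_mat[of G n n "W k" m "H * V" L])
    also have "c \<cdot>\<^sub>m \<dots> = G * X"
      unfolding X_def using G WHV by (intro mult_smult_distrib[symmetric]) auto
    finally have MV: "moment \<gamma> A B k * V = G * X" .
    obtain j where j: "j < L" "x = col (G * X) j"
      using \<open>x \<in> _\<close> X unfolding MV by (auto simp: in_set_conv_nth)
    then have "x = G *\<^sub>v col X j" using col_mult2[OF G X] by simp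
    moreover have "col X j $ i = 0" if "t \<le> i" "i < n" for i
    proof -
      have "row (W k) i = 0\<^sub>v m" using W0 that W[of k] by (intro eq_vecI) auto
      then have "(W k * (H * V)) $$ (i, j) = 0"
        using j(1) that carrier_matD[OF W] carrier_matD[OF HV] col_dim[of "H * V" j] by simp
      then show ?thesis using j(1) that carrier_matD[OF WHV] by (simp add: X_def del: index_mult_mat)
    qed
    ultimately show ?thesis
      unfolding U_eq using mult_vec_in_range_col_block[OF G _ tn, of "col X j"] X by auto
  qed
  define k where "k = dim_col S"
  have S: "S \<in> carrier_mat n k" unfolding k_def assms(14) hcat_def by auto
  have SU: "range_mat S \<subseteq> range_mat U"
  proof (rule range_mat_subsetI[OF S U])
    fix j assume j: "j < k"
    let ?cs = "concat (map cols (map (\<lambda>k. moment \<gamma> A B k * V) [0..<M]))"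
    have "set ?cs \<subseteq> carrier_vec n"
      using moment_cols mult_mat_vec_carrier[OF U] unfolding range_mat_eq[OF U] by fastforce
    then have "cols S = ?cs" unfolding assms(14) hcat_def by (rule cols_mat_of_cols)
    moreover have "col S j \<in> set (cols S)" using j by (simp add: k_def cols_def)
    ultimately have "col S j \<in> set ?cs" by (simp only:)
    then obtain a where "col S j \<in> set (cols (moment \<gamma> A B a * V))" by auto
    then show "col S j \<in> range_mat U" by (rule moment_cols)
  qed

  \<comment> \<open>Eigenvectors orthogonal to the singular directions\<close>
  have "dim_row X = n" using assms(15) A by (auto simp: eigenvectors_in_Omega_def)
  then have X: "X \<in> carrier_mat n (dim_col X)" by auto
  have XU: "range_mat X \<subseteq> range_mat U"
  proof (rule range_mat_subsetI[OF X U])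
    fix j assume "j < dim_col X"
    then have "col X j \<in> set (cols X)" by (auto simp: cols_def)
    then obtain i where i: "i < s" "pencil_eigenvector A B (col X j) (snd (fb ! i))"
      and "col X j \<in> orth_compl n (range_mat (Q_sing Q q))"
      using assms(15) Q by (auto simp: eigenvectors_in_Omega_def)
    define x where "x = col X j"
    define z where "z = snd (fb ! i)"
    have x: "x \<in> carrier_vec n" using i(2) A by (simp add: pencil_eigenvector_def x_def)
    have "x \<in> range_mat E" unfolding rangeE x_def by fact
    then obtain u where u: "u \<in> carrier_vec n" "x = E *\<^sub>v u" using range_mat_eq[OF E(1)] by auto
    have Ex: "E *\<^sub>v x = x"
      unfolding u(2) using E u by (subst assoc_mult_mat_vec[of _ n n _ n, symmetric]) auto
    have "z \<in> \<Omega>" using assms(6) i by (simp add: z_def)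
    then have z: "z \<notin> \<Lambda>2" using assms(3) out inside_Int_outside[of "path_image \<gamma>"] by blast
    have "T z *\<^sub>v x = z \<cdot>\<^sub>v (B *\<^sub>v x) - A *\<^sub>v x"
      unfolding T_def pencil_def using A B x
      by (subst minus_mult_distrib_mat_vec[of _ m n]) (auto simp: smult_mat_mult_vec[of B m n])
    then have Tx: "T z *\<^sub>v x = 0\<^sub>v m"
      using i(2) A B x by (simp add: pencil_eigenvector_def x_def z_def)
    \<comment> \<open>Coordinates of the eigenvector with respect to the columns of
      \<open>Q\<close>; the Kronecker form at \<open>z\<close> annihilates them.\<close>
    define y where "y = Q' *\<^sub>v x"
    have y: "y \<in> carrier_vec n" using Q' x by (simp add: y_def)
    have Qy: "Q *\<^sub>v y = x"
      unfolding y_def using Q Q' x by (subst assoc_mult_mat_vec[of _ n n _ n, symmetric]) auto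
    have PT: "P * T z \<in> carrier_mat m n" using P(1) T by (rule mult_carrier_mat)
    have Ky: "P * T z * Q *\<^sub>v y = 0\<^sub>v m"
    proof -
      have "P * T z * Q *\<^sub>v y = P *\<^sub>v (T z *\<^sub>v x)"
        by (simp only: assoc_mult_mat_vec[OF PT Q(1) y] Qy assoc_mult_mat_vec[OF P(1) T x])
      also have "\<dots> = 0\<^sub>v m" unfolding Tx using P(1) by (intro eq_vecI) auto
      finally show ?thesis .
    qed
    define R' where "R' = block_diag (block_diag (0\<^sub>m t t) (R2 z)) (0\<^sub>m q r)"
    define D' where "D' = block_diag (block_diag (0\<^sub>m t t) (1\<^sub>m t')) (0\<^sub>m q q)"
    have R': "R' \<in> carrier_mat n m" unfolding R'_def m n N_def using R2 by simp
    have KC: "P * T z * Q \<in> carrier_mat m n" using PT Q(1) by (rule mult_carrier_mat)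
    have "R' * (P * T z * Q) = D'"
      unfolding K R'_def D'_def
      using block_diag_mult[of "block_diag (0\<^sub>m t t) (R2 z)" N N "0\<^sub>m q r" q r
          "block_diag (K1 z) (K2 z)" N "0\<^sub>m r q" q]
        block_diag_mult[OF _ R2(1) K1 K2, of "0\<^sub>m t t" t z z z] R2 K1 K2 z
      by (simp add: N_def left_mult_zero_mat[OF K1])
    then have Dy: "D' *\<^sub>v y = 0\<^sub>v n"
      using assoc_mult_mat_vec[OF R' KC y] Ky R' by auto
    have y0: "y $ a = 0" if "t \<le> a" "a < N" for a
    proof -
      have "row D' a = unit_vec n a"
        using that by (intro eq_vecI) (auto simp: D'_def block_diag_index N_def n)
      then have "(D' *\<^sub>v y) $ a = y $ a" using that y n by (simp add: D'_def N_def)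
      then show ?thesis using Dy that n by simp
    qed
    \<comment> \<open>Erasing the singular coordinates makes all coordinates from \<open>t\<close>
      on zero without changing \<open>G *\<^sub>v y\<close>, and this vector is
      \<open>E *\<^sub>v x\<close>, that is, \<open>x\<close>.\<close>
    define y' where "y' = block_diag (1\<^sub>m N) (0\<^sub>m q q) *\<^sub>v y"
    have D: "block_diag (1\<^sub>m N) (0\<^sub>m q q) \<in> carrier_mat n n" by (simp add: n)
    have y': "y' \<in> carrier_vec n" unfolding y'_def using D y by (rule mult_mat_vec_carrier)
    have "y' $ a = 0" if "t \<le> a" "a < n" for a
    proof -
      have "row (block_diag (1\<^sub>m N) (0\<^sub>m q q)) a = (if a < N then unit_vec n a else 0\<^sub>v n)"
        using that by (intro eq_vecI) (auto simp: block_diag_index n)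
      then show ?thesis using that y y0 n by (simp add: y'_def)
    qed
    then have "G *\<^sub>v y' \<in> range_mat U"
      unfolding U_eq using mult_vec_in_range_col_block[OF G y' tn] by blast
    also have "G *\<^sub>v y' = G *\<^sub>v y"
      unfolding y'_def using assoc_mult_mat_vec[OF G D y] GD by simp
    also have "\<dots> = x"
      unfolding G_def using assoc_mult_mat_vec[OF E(1) Q(1) y] Qy Ex by simp
    finally show "col X j \<in> range_mat U" by (simp add: x_def)
  qed

  \<comment> \<open>Full column rank of the projected blocks\<close>
  have rankU: "vec_space.rank n U = t"
  proof (rule rank_injective[OF U])
    fix u :: "complex Matrix.vec" assume u: "u \<in> carrier_vec t" "U *\<^sub>v u = 0\<^sub>v n"
    define v where "v = pad_vec n 0 u"
    have v: "v \<in> carrier_vec n" by (simp add: v_def)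
    have C: "Q_sing Q q \<in> carrier_mat n q" using Q by simp
    have Qv: "Q *\<^sub>v v \<in> carrier_vec n" using Q v by simp
    \<comment> \<open>As \<open>E\<close> kills \<open>Q *\<^sub>v v\<close>, the entries of
      \<open>w\<close> are its coefficients in the columns of Q_s. Then \<open>v\<close> equals
      \<open>pad_vec n N w\<close>, although \<open>v\<close> is supported below \<open>t\<close>
      and the other vector from \<open>N\<close> on; both are zero.\<close>
    define w where "w = Y *\<^sub>v (Q *\<^sub>v v)"
    have w: "w \<in> carrier_vec q" using Y Qv by (simp add: w_def)
    have "G *\<^sub>v v = 0\<^sub>v n" using col_block_mult_vec[OF G u(1), of 0] u tn by (simp add: U_eq v_def)
    then have "E *\<^sub>v (Q *\<^sub>v v) = 0\<^sub>v n" using assoc_mult_mat_vec[OF E(1) Q(1) v] by (simp add: G_def)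
    moreover have "E *\<^sub>v (Q *\<^sub>v v) = Q *\<^sub>v v - Q_sing Q q *\<^sub>v w"
      unfolding Y(2) w_def using C Y Qv
      by (subst minus_mult_distrib_mat_vec[of _ n n]) auto
    ultimately have "Q *\<^sub>v v - Q_sing Q q *\<^sub>v w = 0\<^sub>v n" by simp
    then have "(Q *\<^sub>v v - Q_sing Q q *\<^sub>v w) $ i = 0" if "i < n" for i
      using that by simp
    then have "Q *\<^sub>v v = Q_sing Q q *\<^sub>v w"
      using carrier_matD[OF C] carrier_matD[OF Q(1)] by (intro eq_vecI) auto
    also have "\<dots> = Q *\<^sub>v pad_vec n N w"
      unfolding Q_sing_def using col_block_mult_vec[OF Q(1) w, of N] Q n by simp
    finally have "Q' *\<^sub>v (Q *\<^sub>v v) = Q' *\<^sub>v (Q *\<^sub>v pad_vec n N w)" by simp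
    then have eq: "v = pad_vec n N w"
      using assoc_mult_mat_vec[OF Q'(1) Q(1), symmetric] Q' v by simp
    show "u = 0\<^sub>v t"
    proof (rule eq_vecI)
      fix i assume "i < dim_vec (0\<^sub>v t :: complex Matrix.vec)"
      then show "u $ i = 0\<^sub>v t $ i"
        using arg_cong[OF eq, of "\<lambda>v. v $ i"] u tN tn by (simp add: v_def pad_vec_index)
    qed (use u in auto)
  qed
  \<comment> \<open>Once the ranges of \<open>U\<close> and \<open>S\<close> agree, the inclusion
    \<open>XU\<close> passes to \<open>S\<close>, so the claim reduces to the rank
    criterion.\<close>
  show ?thesis
    using rank_eq_iff_range_eq[OF S U rankU SU] XU unfolding U_def by blast
qed

end
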